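(* Let $1<p<\infty$. Then for every $f\in L^p(\mathbb{T})$, $$\lim_{n\to\infty}\|S_n(f)-f\|_{L^p(\mathbb{T})}=0 .$$
   Context: $\mathbb{T}=\mathbb{R}/2\pi\mathbb{Z}$. $L^p(\mathbb{T})$ is the space of complex-valued $2\pi$-periodic measurable functions with finite norm $\|f\|_{L^p(\mathbb{T})}=\big(\frac{1}{2\pi}\int_{\mathbb{T}}|f(t)|^p\,dt\big)^{1/p}$, where $\int_{\mathbb{T}}$ is taken over any interval of length $2\pi$. For $f\in L^1(\mathbb{T})$ and $n\in\mathbb{Z}$, the Fourier coefficient is $\hat f(n)=\frac{1}{2\pi}\int_{\mathbb{T}}f(t)e^{-int}\,dt$, and for $n\ge 0$ the $n$-th partial sum of the Fourier series is $S_n(f)(t)=\sum_{j=-n}^{n}\hat f(j)e^{ijt}$. *)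

theory Defs
  imports "HOL-Analysis.Analysis"
begin

(* Functions on the circle R / 2 pi Z are represented by 2 pi-periodic functions on the real
   line; by periodicity, every integral over the circle is taken over [-pi, pi]. *)

definition periodic_2pi :: "(real \<Rightarrow> complex) \<Rightarrow> bool" where
  "periodic_2pi f \<longleftrightarrow> (\<forall>t. f (t + 2 * pi) = f t)"

(* Elements of this set are functions, not almost-everywhere equivalence classes; the norm below
   and the Fourier coefficients only depend on the class.  Measurability is stated separately
   because measurability of the p-th power of the modulus does not imply that of f. *)
definition Lp_circle :: "real \<Rightarrow> (real \<Rightarrow> complex) set" where
  "Lp_circle p = {f. f \<in> borel_measurable lebesgue \<and> periodic_2pi f \<and>
     set_integrable lebesgue {-pi..pi} (\<lambda>t. cmod (f t) powr p)}"

(* The Bochner integral is 0 for non-integrable functions, so this is the Lp norm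
   only on Lp_circle p. *)
definition Lp_norm_circle :: "real \<Rightarrow> (real \<Rightarrow> complex) \<Rightarrow> real" where
  "Lp_norm_circle p f =
     (1 / (2 * pi) * (LINT t:{-pi..pi}|lebesgue. cmod (f t) powr p)) powr (1 / p)"

definition fourier_coeff :: "(real \<Rightarrow> complex) \<Rightarrow> int \<Rightarrow> complex" where
  "fourier_coeff f n =
     1 / (2 * of_real pi) * (LINT t:{-pi..pi}|lebesgue. f t * exp (- (\<i> * of_int n * of_real t)))"

definition fourier_sum :: "nat \<Rightarrow> (real \<Rightarrow> complex) \<Rightarrow> real \<Rightarrow> complex" where
  "fourier_sum n f t =
     (\<Sum>j = - int n..int n. fourier_coeff f j * exp (\<i> * of_int j * of_real t))"

(* The next facts show that no integral used in the definitions takes its default value 0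
   when f lies in Lp_circle p and p is at least 1. *)

lemma Lp_circle_subset_L1:
  assumes "f \<in> Lp_circle p" "1 \<le> p"
  shows "f \<in> Lp_circle 1"
proof -
  have f: "f \<in> borel_measurable lebesgue" "periodic_2pi f"
    and i: "set_integrable lebesgue {-pi..pi} (\<lambda>t. cmod (f t) powr p)"
    using assms by (auto simp: Lp_circle_def)
  have *: "x powr 1 \<le> 1 + x powr p" if "0 \<le> x" for x :: real
  proof (cases "x \<le> 1")
    case True
    then show ?thesis using that by (simp add: add_increasing2)
  next
    case False
    then have "x powr 1 \<le> x powr p" using assms(2) by (intro powr_mono) auto
    then show ?thesis by simp
  qed
  have "set_integrable lebesgue {-pi..pi} (\<lambda>t. 1 + cmod (f t) powr p)"
    by (intro set_integral_add i) (simp add: set_integrable_def)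
  moreover have "set_borel_measurable lebesgue {-pi..pi} (\<lambda>t. cmod (f t) powr 1)"
    using f(1) unfolding set_borel_measurable_def
    by (intro borel_measurable_scaleR borel_measurable_indicator powr_real_measurable borel_measurable_norm) auto
  ultimately have "set_integrable lebesgue {-pi..pi} (\<lambda>t. cmod (f t) powr 1)"
    by (rule set_integrable_bound) (use * in \<open>auto simp: abs_of_nonneg\<close>)
  with f show ?thesis by (simp add: Lp_circle_def)
qed

lemma fourier_coeff_integrable:
  assumes "f \<in> Lp_circle 1"
  shows "set_integrable lebesgue {-pi..pi} (\<lambda>t. f t * exp (- (\<i> * of_int n * of_real t)))"
proof -
  have f: "f \<in> borel_measurable lebesgue"
    and i: "set_integrable lebesgue {-pi..pi} (\<lambda>t. cmod (f t) powr 1)"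
    using assms by (auto simp: Lp_circle_def)
  have e: "(\<lambda>t. exp (- (\<i> * of_int n * complex_of_real t))) \<in> borel_measurable lebesgue"
    by (intro borel_measurable_continuous_onI continuous_intros measurable_completion) auto
  have "set_borel_measurable lebesgue {-pi..pi} (\<lambda>t. f t * exp (- (\<i> * of_int n * of_real t)))"
    using f e unfolding set_borel_measurable_def
    by (intro borel_measurable_scaleR borel_measurable_indicator borel_measurable_times) auto
  with i show ?thesis
    by (rule set_integrable_bound) (auto simp: norm_mult)
qed

lemma fourier_sum_diff_in_Lp:
  assumes "f \<in> Lp_circle p" "1 \<le> p"
  shows "(\<lambda>t. fourier_sum n f t - f t) \<in> Lp_circle p"
proof -
  have f: "f \<in> borel_measurable lebesgue" "periodic_2pi f"
    and i: "set_integrable lebesgue {-pi..pi} (\<lambda>t. cmod (f t) powr p)"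
    using assms by (auto simp: Lp_circle_def)
  define C where "C = (\<Sum>j = - int n..int n. cmod (fourier_coeff f j))"
  have C: "cmod (fourier_sum n f t) \<le> C" for t
    unfolding fourier_sum_def C_def
    by (rule sum_norm_le) (simp add: norm_mult)
  have m: "fourier_sum n f \<in> borel_measurable lebesgue"
    unfolding fourier_sum_def[abs_def]
    by (intro borel_measurable_continuous_onI continuous_intros measurable_completion) auto
  have per: "fourier_sum n f (t + 2 * pi) = fourier_sum n f t" for t
  proof -
    have "exp (\<i> * of_int j * of_real (t + 2 * pi)) = exp (\<i> * of_int j * of_real t)" for j
    proof -
      have "\<i> * of_int j * of_real (t + 2 * pi)
          = \<i> * of_int j * of_real t + complex_of_real (2 * of_int j * pi) * \<i>"
        by (simp add: algebra_simps)
      then show ?thesis unfolding exp_eq by auto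
    qed
    then show ?thesis by (simp only: fourier_sum_def)
  qed
  have *: "cmod (fourier_sum n f t - f t) powr p \<le> 2 powr p * (C powr p + cmod (f t) powr p)" for t
  proof -
    have C0: "0 \<le> C" unfolding C_def by (rule sum_nonneg) simp
    have "cmod (fourier_sum n f t - f t) \<le> C + cmod (f t)"
      using norm_triangle_ineq4[of "fourier_sum n f t" "f t"] C[of t] by linarith
    also have "\<dots> \<le> 2 * max C (cmod (f t))" by simp
    finally have "cmod (fourier_sum n f t - f t) powr p \<le> (2 * max C (cmod (f t))) powr p"
      using assms(2) by (intro powr_mono2) auto
    also have "\<dots> = 2 powr p * max C (cmod (f t)) powr p"
      using C0 by (simp add: powr_mult)
    also have "\<dots> \<le> 2 powr p * (C powr p + cmod (f t) powr p)"
      by (intro mult_left_mono) (auto simp: max_def)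
    finally show ?thesis .
  qed
  have "set_integrable lebesgue {-pi..pi} (\<lambda>t. 2 powr p * (C powr p + cmod (f t) powr p))"
    by (intro set_integrable_mult_right set_integral_add i) (simp add: set_integrable_def)
  moreover have "set_borel_measurable lebesgue {-pi..pi} (\<lambda>t. cmod (fourier_sum n f t - f t) powr p)"
    using f(1) m unfolding set_borel_measurable_def
    by (intro borel_measurable_scaleR borel_measurable_indicator powr_real_measurable
        borel_measurable_norm borel_measurable_diff) auto
  ultimately have "set_integrable lebesgue {-pi..pi} (\<lambda>t. cmod (fourier_sum n f t - f t) powr p)"
    by (rule set_integrable_bound) (use * in \<open>auto simp: abs_of_nonneg\<close>)
  with f m per show ?thesis by (simp add: Lp_circle_def periodic_2pi_def)
qed

end

theory Submission
  imports Defs "HOL-Complex_Analysis.Conformal_Mappings"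
begin

text \<open>
  Since trigonometric polynomials are dense in \<open>L\<^sup>p\<close> (\<open>trig_poly_dense\<close>) and are reproduced by their
  partial sums of large order, norm convergence amounts to M. Riesz's theorem: the partial sum
  operators are bounded on \<open>L\<^sup>p\<close> uniformly in their order (\<open>fourier_sum_bound\<close>).

  A partial sum is a difference of two modulated projections onto the nonnegative frequencies
  (\<open>fourier_sum_eq_riesz_proj_diff\<close>), so for \<open>1 < p \<le> 2\<close> it suffices to bound this projection on
  trigonometric polynomials. Let first \<open>u\<close> be a positive one. Then \<open>u\<close> is the boundary
  value of \<open>Re F\<close> for a polynomial \<open>F\<close>, which by the minimum principle maps the closed disc
  into the right half-plane. There \<open>F powr p\<close> is holomorphic and one has the pointwise inequality
  \<open>cmod z powr p \<le> A * Re z powr p - B * Re (z powr p)\<close> (\<open>norm_powr_le_Re\<close>), valid because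
  \<open>cos (p * x)\<close> is negative for \<open>x\<close> near \<open>\<plusminus>\<pi>/2\<close>. Integrated over the circle, the last term becomes
  a nonpositive number by the mean value property, so the \<open>p\<close>-mass of \<open>F\<close> is controlled by that of
  \<open>u\<close> (\<open>Lp_mass_analytic_le_Re\<close>). An arbitrary trigonometric polynomial \<open>f\<close> is a combination of
  three positive ones of comparable size, built from a trigonometric polynomial slightly larger
  than \<open>\<bar>f\<bar>\<close> (\<open>riesz_proj_bound_trig_poly\<close>).

  For \<open>p \<ge> 2\<close> the bound follows by duality (\<open>fourier_sum_bound_ge_2\<close>): partial sums are symmetric
  for the pairing \<open>\<integral> f g\<close>, and the conjugate exponent lies in the range already treated.
\<close>

section \<open>Integration over one period\<close>

abbreviation circle :: "real measure" where
  "circle \<equiv> lebesgue_on {-pi..pi}"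

text \<open>
  Only the values on one period matter for the integrals below, so periodicity is not imposed:
  truncations and auxiliary test functions then need not be extended periodically.
\<close>
definition Lp_period :: "real \<Rightarrow> (real \<Rightarrow> complex) set" where
  "Lp_period p = {f \<in> borel_measurable circle. integrable circle (\<lambda>t. cmod (f t) powr p)}"

text \<open>
  The unnormalised \<open>p\<close>-th power of the \<open>L\<^sup>p\<close> norm. All estimates are stated for it, because
  the crude bound \<open>(a + b)\<^sup>p \<le> 2\<^sup>p (a\<^sup>p + b\<^sup>p)\<close> is then a sufficient replacement for Minkowski's
  inequality: only the finiteness of the constants counts, not their size.
\<close>
definition Lp_mass :: "real \<Rightarrow> (real \<Rightarrow> complex) \<Rightarrow> real" where
  "Lp_mass p f = (\<integral>t. cmod (f t) powr p \<partial>circle)"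

lemma finite_measure_circle: "finite_measure circle"
  by (intro finite_measure_lebesgue_on) simp

lemma measure_circle: "measure circle (space circle) = 2 * pi"
  by (simp add: measure_restrict_space)

lemma integrable_bounded_circle:
  fixes f :: "real \<Rightarrow> 'a::{banach, second_countable_topology}"
  assumes "f \<in> borel_measurable circle" "\<And>t. t \<in> {-pi..pi} \<Longrightarrow> norm (f t) \<le> B"
  shows "integrable circle f"
  by (rule finite_measure.integrable_const_bound[OF finite_measure_circle _ assms(1), where B = B])
     (auto intro!: AE_I2 assms(2))

lemma powr_add_le:
  fixes a b p :: real
  assumes "0 \<le> a" "0 \<le> b" "0 < p"
  shows "(a + b) powr p \<le> 2 powr p * (a powr p + b powr p)"
proof -
  have "(a + b) powr p \<le> (2 * max a b) powr p"
    using assms by (intro powr_mono2) auto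
  also have "\<dots> = 2 powr p * max a b powr p"
    using assms by (simp add: powr_mult)
  also have "\<dots> \<le> 2 powr p * (a powr p + b powr p)"
    by (intro mult_left_mono) (auto simp: max_def)
  finally show ?thesis .
qed

lemma Lp_mass_nonneg: "0 \<le> Lp_mass p f"
  unfolding Lp_mass_def by (intro Bochner_Integration.integral_nonneg) auto

lemma Lp_period_bounded:
  assumes "f \<in> borel_measurable circle" "\<And>t. t \<in> {-pi..pi} \<Longrightarrow> cmod (f t) \<le> B" "0 < p"
  shows "f \<in> Lp_period p"
proof -
  have "integrable circle (\<lambda>t. cmod (f t) powr p)"
    using assms by (intro integrable_bounded_circle[where B = "B powr p"])
      (auto intro!: powr_mono2)
  then show ?thesis using assms by (simp add: Lp_period_def)
qed

lemma Lp_period_continuous: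
  assumes "continuous_on {-pi..pi} f" "0 < p"
  shows "f \<in> Lp_period p"
proof -
  have "bounded (f ` {-pi..pi})"
    by (intro compact_imp_bounded compact_continuous_image assms) simp
  then obtain B where "\<forall>t\<in>{-pi..pi}. cmod (f t) \<le> B"
    by (auto simp: bounded_iff)
  moreover have "f \<in> borel_measurable circle"
    by (intro continuous_imp_measurable_on_sets_lebesgue assms) simp
  ultimately show ?thesis using assms by (intro Lp_period_bounded[of f B]) auto
qed

lemma
  assumes "f \<in> Lp_period p" "g \<in> Lp_period p" "0 < p"
  shows Lp_period_add: "(\<lambda>t. f t + g t) \<in> Lp_period p"
    and Lp_mass_add: "Lp_mass p (\<lambda>t. f t + g t) \<le> 2 powr p * (Lp_mass p f + Lp_mass p g)"
proof -
  have m: "f \<in> borel_measurable circle" "g \<in> borel_measurable circle"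
    and i: "integrable circle (\<lambda>t. cmod (f t) powr p)" "integrable circle (\<lambda>t. cmod (g t) powr p)"
    using assms by (auto simp: Lp_period_def)
  have le: "cmod (f t + g t) powr p \<le> 2 powr p * (cmod (f t) powr p + cmod (g t) powr p)" for t
  proof -
    have "cmod (f t + g t) powr p \<le> (cmod (f t) + cmod (g t)) powr p"
      using assms by (intro powr_mono2) (auto simp: norm_triangle_ineq)
    also have "\<dots> \<le> 2 powr p * (cmod (f t) powr p + cmod (g t) powr p)"
      using assms by (intro powr_add_le) auto
    finally show ?thesis .
  qed
  have i2: "integrable circle (\<lambda>t. 2 powr p * (cmod (f t) powr p + cmod (g t) powr p))"
    using i by auto
  have i3: "integrable circle (\<lambda>t. cmod (f t + g t) powr p)"
    using m le by (intro Bochner_Integration.integrable_bound[OF i2]) (auto intro!: AE_I2)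
  then show "(\<lambda>t. f t + g t) \<in> Lp_period p"
    using m by (simp add: Lp_period_def)
  have "Lp_mass p (\<lambda>t. f t + g t) \<le> (\<integral>t. 2 powr p * (cmod (f t) powr p + cmod (g t) powr p) \<partial>circle)"
    unfolding Lp_mass_def by (intro integral_mono i2 i3 le)
  also have "\<dots> = 2 powr p * (Lp_mass p f + Lp_mass p g)"
    unfolding Lp_mass_def using i by simp
  finally show "Lp_mass p (\<lambda>t. f t + g t) \<le> 2 powr p * (Lp_mass p f + Lp_mass p g)" .
qed

lemma Lp_mass_mult: "Lp_mass p (\<lambda>t. c * f t) = cmod c powr p * Lp_mass p f"
  unfolding Lp_mass_def by (simp add: norm_mult powr_mult)

lemma Lp_period_mult: "f \<in> Lp_period p \<Longrightarrow> (\<lambda>t. c * f t) \<in> Lp_period p"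
  by (auto simp: Lp_period_def norm_mult powr_mult intro!: borel_measurable_times)

lemma Lp_period_diff:
  assumes "f \<in> Lp_period p" "g \<in> Lp_period p" "0 < p"
  shows "(\<lambda>t. f t - g t) \<in> Lp_period p"
  using Lp_period_add[OF assms(1) Lp_period_mult[OF assms(2), of "-1"] assms(3)] by simp

lemma Lp_mass_diff:
  assumes "f \<in> Lp_period p" "g \<in> Lp_period p" "0 < p"
  shows "Lp_mass p (\<lambda>t. f t - g t) \<le> 2 powr p * (Lp_mass p f + Lp_mass p g)"
  using Lp_mass_add[OF assms(1) Lp_period_mult[OF assms(2), of "-1"] assms(3)]
  by (simp add: Lp_mass_mult[of p "-1" g, simplified])

lemma Lp_mass_mono:
  assumes "f \<in> Lp_period p" "g \<in> Lp_period p" "0 < p"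
    "\<And>t. t \<in> {-pi..pi} \<Longrightarrow> cmod (f t) \<le> cmod (g t)"
  shows "Lp_mass p f \<le> Lp_mass p g"
  unfolding Lp_mass_def using assms
  by (intro integral_mono) (auto simp: Lp_period_def intro!: powr_mono2)

lemma Lp_mass_const: "Lp_mass p (\<lambda>t. c) = 2 * pi * cmod c powr p"
  using measure_circle by (simp add: Lp_mass_def)

lemma Lp_mass_le_bound:
  assumes "f \<in> Lp_period p" "0 < p" "\<And>t. t \<in> {-pi..pi} \<Longrightarrow> cmod (f t) \<le> B"
  shows "Lp_mass p f \<le> 2 * pi * B powr p"
proof -
  have "0 \<le> B" using order_trans[OF norm_ge_zero assms(3)[of 0]] by simp
  then have "Lp_mass p f \<le> Lp_mass p (\<lambda>t. of_real B)"
    using assms Lp_period_continuous[of "\<lambda>t. complex_of_real B" p]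
    by (intro Lp_mass_mono) auto
  with \<open>0 \<le> B\<close> show ?thesis by (simp add: Lp_mass_const)
qed

text \<open>
  Below \<open>\<eta>\<close> the first summand dominates \<open>x\<close>, and above it
  \<open>x = x powr (1 - p) * x powr p\<close> whose first factor is nonincreasing in \<open>x\<close>. Integrated, this controls the
  \<open>L\<^sup>1\<close> norm by the \<open>p\<close>-mass without Hoelder's inequality, and shows that the former tends to
  \<open>0\<close> together with the latter.
\<close>
lemma le_eps_plus_powr:
  fixes x \<eta> p :: real
  assumes "0 \<le> x" "0 < \<eta>" "1 \<le> p"
  shows "x \<le> \<eta> + \<eta> powr (1 - p) * x powr p"
proof (cases "x \<le> \<eta>")
  case True
  then show ?thesis by (simp add: add_increasing2)
next
  case False
  then have x: "\<eta> < x" "0 < x" using assms by auto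
  have "x = x powr (1 - p) * x powr p" using x by (simp flip: powr_add)
  also have "\<dots> \<le> \<eta> powr (1 - p) * x powr p"
    using x assms by (intro mult_right_mono powr_mono2') auto
  finally show ?thesis using assms by linarith
qed

lemma Lp_period_integrable:
  assumes "f \<in> Lp_period p" "1 \<le> p"
  shows "integrable circle f"
proof -
  have i: "integrable circle (\<lambda>t. 1 + cmod (f t) powr p)" and m: "f \<in> borel_measurable circle"
    using assms finite_measure.integrable_const[OF finite_measure_circle] 
    by (auto simp: Lp_period_def)
  show ?thesis
    using le_eps_plus_powr[of "cmod (f t)" 1 p for t] assms
    by (intro Bochner_Integration.integrable_bound[OF i m]) (auto intro!: AE_I2)
qed

lemma L1_norm_le_Lp_mass:
  assumes "f \<in> Lp_period p" "1 \<le> p" "0 < \<eta>"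
  shows "(\<integral>t. cmod (f t) \<partial>circle) \<le> 2 * pi * \<eta> + \<eta> powr (1 - p) * Lp_mass p f"
proof -
  have i: "integrable circle (\<lambda>t. \<eta>)" "integrable circle (\<lambda>t. cmod (f t) powr p)"
    using assms finite_measure.integrable_const[OF finite_measure_circle] 
    by (auto simp: Lp_period_def)
  have "(\<integral>t. cmod (f t) \<partial>circle) \<le> (\<integral>t. \<eta> + \<eta> powr (1 - p) * cmod (f t) powr p \<partial>circle)"
    using Lp_period_integrable[OF assms(1,2)] i le_eps_plus_powr assms
    by (intro integral_mono) auto
  also have "\<dots> = 2 * pi * \<eta> + \<eta> powr (1 - p) * Lp_mass p f"
    using i measure_circle by (simp add: Lp_mass_def)
  finally show ?thesis .
qed

lemma Lp_circle_imp_Lp_period: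
  assumes "f \<in> Lp_circle p" shows "f \<in> Lp_period p"
  using assms unfolding Lp_circle_def Lp_period_def
  by (auto simp: set_integrable_eq measurable_restrict_space1)

lemma Lp_norm_circle_eq: "Lp_norm_circle p f = (1 / (2 * pi) * Lp_mass p f) powr (1 / p)"
  unfolding Lp_norm_circle_def Lp_mass_def
  by (simp add: set_lebesgue_integral_def integral_restrict_space)

section \<open>Harmonics and trigonometric polynomials\<close>

definition harmonic :: "int \<Rightarrow> real \<Rightarrow> complex" where
  "harmonic k t = exp (\<i> * of_int k * of_real t)"

lemma harmonic_add: "harmonic (j + k) t = harmonic j t * harmonic k t"
  by (simp add: harmonic_def algebra_simps flip: exp_add)

lemma harmonic_0 [simp]: "harmonic 0 t = 1"
  by (simp add: harmonic_def)

lemma norm_harmonic [simp]: "cmod (harmonic k t) = 1"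
  by (simp add: harmonic_def)

lemma cnj_harmonic: "cnj (harmonic k t) = harmonic (- k) t"
  by (simp add: harmonic_def exp_cnj)

lemma harmonic_cis: "harmonic (int n) t = cis t ^ n"
  by (simp add: harmonic_def cis_conv_exp mult_ac flip: exp_of_nat_mult)

lemma harmonic_ends: "harmonic k (- pi) = harmonic k pi"
proof -
  have "\<i> * of_int k * complex_of_real pi = \<i> * of_int k * complex_of_real (- pi)
      + complex_of_real (2 * of_int k * pi) * \<i>"
    by (simp add: algebra_simps)
  then have "harmonic k pi = harmonic k (- pi)"
    unfolding harmonic_def exp_eq by (intro exI[of _ k]) simp
  then show ?thesis ..
qed

lemma continuous_on_harmonic [continuous_intros]: "continuous_on S (harmonic k)"
  unfolding harmonic_def[abs_def] by (intro continuous_intros)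

lemma harmonic_measurable [measurable]: "harmonic k \<in> borel_measurable circle"
  by (intro continuous_imp_measurable_on_sets_lebesgue continuous_intros) simp

lemma integral_harmonic: "(\<integral>t. harmonic k t \<partial>circle) = (if k = 0 then 2 * pi else 0)"
proof (cases "k = 0")
  case True
  then show ?thesis using measure_circle by (simp add: scaleR_conv_of_real)
next
  case False
  define F where "F t = exp (\<i> * of_int k * complex_of_real t) / (\<i> * of_int k)" for t
  have "(F has_vector_derivative harmonic k t) (at t within S)" for t S
    unfolding F_def harmonic_def using False
    by (intro has_vector_derivative_real_field) (auto intro!: derivative_eq_intros)
  then have "(harmonic k has_integral (F pi - F (-pi))) {-pi..pi}"
    by (intro fundamental_theorem_of_calculus) auto
  moreover have "F pi = F (-pi)"
    using harmonic_ends[of k] by (simp add: F_def harmonic_def)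
  ultimately have "integral {-pi..pi} (harmonic k) = 0"
    by (simp add: integral_unique)
  moreover have "(\<integral>t. harmonic k t \<partial>circle) = integral {-pi..pi} (harmonic k)"
    by (intro lebesgue_integral_eq_integral continuous_imp_integrable_real continuous_intros) auto
  ultimately show ?thesis using False by simp
qed

lemma fourier_coeff_eq:
  "fourier_coeff f k = 1 / (2 * of_real pi) * (\<integral>t. f t * harmonic (- k) t \<partial>circle)"
proof -
  have "(LINT t:{-pi..pi}|lebesgue. f t * exp (- (\<i> * of_int k * of_real t)))
      = (\<integral>t. f t * harmonic (- k) t \<partial>circle)"
    unfolding harmonic_def
    by (simp add: set_lebesgue_integral_def integral_restrict_space)
  then show ?thesis by (simp add: fourier_coeff_def)
qed

lemma fourier_sum_eq: "fourier_sum n f t = (\<Sum>j = - int n..int n. fourier_coeff f j * harmonic j t)"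
  by (simp add: fourier_sum_def harmonic_def)

lemma integrable_mult_harmonic:
  assumes "integrable circle f" shows "integrable circle (\<lambda>t. f t * harmonic k t)"
  using assms by (intro Bochner_Integration.integrable_bound[OF assms]) (auto simp: norm_mult)

lemma fourier_coeff_add:
  assumes "integrable circle f" "integrable circle g"
  shows "fourier_coeff (\<lambda>t. f t + g t) k = fourier_coeff f k + fourier_coeff g k"
  using assms by (simp add: fourier_coeff_eq integrable_mult_harmonic distrib_right distrib_left)

lemma fourier_coeff_mult: "fourier_coeff (\<lambda>t. c * f t) k = c * fourier_coeff f k"
  by (simp add: fourier_coeff_eq mult.assoc)

lemma fourier_coeff_diff:
  assumes "integrable circle f" "integrable circle g"
  shows "fourier_coeff (\<lambda>t. f t - g t) k = fourier_coeff f k - fourier_coeff g k"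
  using assms by (simp add: fourier_coeff_eq integrable_mult_harmonic left_diff_distrib right_diff_distrib)

text \<open>
  Multiplication by a harmonic shifts the spectrum. This is how partial sums will be expressed by
  projections onto the nonnegative frequencies.
\<close>
lemma fourier_coeff_modulate: "fourier_coeff (\<lambda>t. harmonic m t * f t) k = fourier_coeff f (k - m)"
proof -
  have "harmonic m t * f t * harmonic (- k) t = f t * harmonic (- (k - m)) t" for t
    using harmonic_add[of m "- k" t] by simp
  then show ?thesis by (simp only: fourier_coeff_eq)
qed

lemma fourier_coeff_harmonic: "fourier_coeff (harmonic m) k = (if k = m then 1 else 0)"
proof -
  have "harmonic m t * harmonic (- k) t = harmonic (m - k) t" for t
    using harmonic_add[of m "- k" t] by simp
  then show ?thesis by (simp add: fourier_coeff_eq integral_harmonic)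
qed

lemma fourier_coeff_real:
  shows "cnj (fourier_coeff (\<lambda>t. of_real (u t)) k) = fourier_coeff (\<lambda>t. of_real (u t)) (- k)"
proof -
  have "cnj (\<integral>t. of_real (u t) * harmonic (- k) t \<partial>circle)
      = (\<integral>t. cnj (of_real (u t) * harmonic (- k) t) \<partial>circle)"
    by (rule Bochner_Integration.integral_cnj[symmetric])
  then show ?thesis by (simp add: fourier_coeff_eq cnj_harmonic)
qed

lemma fourier_sum_add:
  assumes "integrable circle f" "integrable circle g"
  shows "fourier_sum n (\<lambda>t. f t + g t) t = fourier_sum n f t + fourier_sum n g t"
  by (simp add: fourier_sum_eq fourier_coeff_add[OF assms] distrib_right sum.distrib)

lemma fourier_sum_diff:
  assumes "integrable circle f" "integrable circle g"
  shows "fourier_sum n (\<lambda>t. f t - g t) t = fourier_sum n f t - fourier_sum n g t"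
  by (simp add: fourier_sum_eq fourier_coeff_diff[OF assms] left_diff_distrib sum_subtractf)

lemma continuous_on_fourier_sum [continuous_intros]: "continuous_on S (fourier_sum n f)"
  unfolding fourier_sum_eq[abs_def] by (intro continuous_intros)

lemma norm_fourier_coeff_le:
  assumes "integrable circle f"
  shows "cmod (fourier_coeff f k) \<le> (\<integral>t. cmod (f t) \<partial>circle)"
proof -
  have "cmod (fourier_coeff f k) \<le> 1 / (2 * pi) * (\<integral>t. cmod (f t * harmonic (- k) t) \<partial>circle)"
    using integral_norm_bound[of circle "\<lambda>t. f t * harmonic (- k) t"]
    unfolding fourier_coeff_eq norm_mult[of "1 / (2 * complex_of_real pi)"]
    by (simp add: norm_divide divide_right_mono)
  also have "\<dots> = 1 / (2 * pi) * (\<integral>t. cmod (f t) \<partial>circle)"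
    by (simp add: norm_mult)
  also have "\<dots> \<le> 1 * (\<integral>t. cmod (f t) \<partial>circle)"
    using pi_ge_two by (intro mult_right_mono) (auto simp: divide_simps)
  finally show ?thesis by simp
qed

text \<open>
  Defined by generation rather than by a coefficient sequence, so that closure under products,
  conjugation and real parts follows by induction without convolving coefficients.
\<close>
inductive trig_poly :: "(real \<Rightarrow> complex) \<Rightarrow> bool" where
  trig_poly_harmonic: "trig_poly (\<lambda>t. c * harmonic k t)"
| trig_poly_add: "trig_poly f \<Longrightarrow> trig_poly g \<Longrightarrow> trig_poly (\<lambda>t. f t + g t)"

lemma trig_poly_const: "trig_poly (\<lambda>t. c)"
  using trig_poly_harmonic[of c 0] by simp

lemma trig_poly_mult_harmonic: "trig_poly f \<Longrightarrow> trig_poly (\<lambda>t. c * harmonic k t * f t)"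
proof (induction rule: trig_poly.induct)
  case (trig_poly_harmonic d j)
  have "(\<lambda>t. c * harmonic k t * (d * harmonic j t)) = (\<lambda>t. c * d * harmonic (k + j) t)"
    by (simp add: harmonic_add mult_ac)
  then show ?case using trig_poly.trig_poly_harmonic[of "c * d" "k + j"] by simp
next
  case (trig_poly_add f g)
  then show ?case using trig_poly.trig_poly_add by (simp add: distrib_left)
qed

lemma trig_poly_mult: "trig_poly f \<Longrightarrow> trig_poly g \<Longrightarrow> trig_poly (\<lambda>t. f t * g t)"
proof (induction rule: trig_poly.induct)
  case (trig_poly_harmonic c k)
  then show ?case by (rule trig_poly_mult_harmonic)
next
  case (trig_poly_add f g)
  then show ?case using trig_poly.trig_poly_add by (simp add: distrib_right)
qed

lemma trig_poly_cnj: "trig_poly f \<Longrightarrow> trig_poly (\<lambda>t. cnj (f t))"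
proof (induction rule: trig_poly.induct)
  case (trig_poly_harmonic c k)
  then show ?case using trig_poly.trig_poly_harmonic[of "cnj c" "-k"] by (simp add: cnj_harmonic)
next
  case (trig_poly_add f g)
  then show ?case using trig_poly.trig_poly_add by simp
qed

lemma trig_poly_Re:
  assumes "trig_poly f" shows "trig_poly (\<lambda>t. of_real (Re (f t)))"
proof -
  have "trig_poly (\<lambda>t. (1/2) * (f t + cnj (f t)))"
    by (intro trig_poly_mult trig_poly_const trig_poly_add trig_poly_cnj assms)
  then show ?thesis by (simp add: complex_add_cnj)
qed

lemma trig_poly_Im:
  assumes "trig_poly f" shows "trig_poly (\<lambda>t. of_real (Im (f t)))"
  using trig_poly_Re[OF trig_poly_mult[OF trig_poly_const[of "-\<i>"] assms]] by simp

lemma continuous_on_trig_poly: "trig_poly f \<Longrightarrow> continuous_on S f"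
  by (induction rule: trig_poly.induct) (auto intro!: continuous_intros)

lemma trig_poly_ends: "trig_poly f \<Longrightarrow> f (- pi) = f pi"
  by (induction rule: trig_poly.induct) (simp_all add: harmonic_ends)

lemma trig_poly_Lp_period: "trig_poly f \<Longrightarrow> 0 < p \<Longrightarrow> f \<in> Lp_period p"
  by (intro Lp_period_continuous continuous_on_trig_poly)

lemma trig_poly_integrable: "trig_poly f \<Longrightarrow> integrable circle f"
  by (rule Lp_period_integrable[of _ 1]) (auto intro: trig_poly_Lp_period)

lemma fourier_sum_trig_poly:
  assumes "trig_poly f" shows "\<forall>\<^sub>F n in sequentially. \<forall>t. fourier_sum n f t = f t"
  using assms
proof (induction rule: trig_poly.induct)
  case (trig_poly_harmonic c k)
  have "fourier_sum n (\<lambda>t. c * harmonic k t) t = c * harmonic k t" if "nat \<bar>k\<bar> \<le> n" for n t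
  proof -
    have "fourier_sum n (\<lambda>t. c * harmonic k t) t = 
        (\<Sum>j = - int n..int n. if j = k then c * harmonic j t else 0)"
      unfolding fourier_sum_eq fourier_coeff_mult fourier_coeff_harmonic
      by (intro sum.cong) auto
    also have "\<dots> = c * harmonic k t" using that by (subst sum.delta) auto
    finally show ?thesis .
  qed
  then show ?case by (auto simp: eventually_sequentially)
next
  case (trig_poly_add f g)
  show ?case using trig_poly_add.IH
    by eventually_elim (use trig_poly_add.hyps in \<open>simp add: fourier_sum_add trig_poly_integrable\<close>)
qed

section \<open>Density of trigonometric polynomials\<close>

text \<open>
  The map \<open>cis\<close> from the compact period onto the unit circle is closed, hence a quotient map; a
  continuous function with equal values at the two ends therefore descends to the circle.
\<close>
lemma continuous_on_factor_cis:
  fixes g :: "real \<Rightarrow> complex"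
  assumes g: "continuous_on {-pi..pi} g" and ends: "g (-pi) = g pi"
  obtains G where "continuous_on (sphere 0 1) G" "\<And>t. t \<in> {-pi..pi} \<Longrightarrow> G (cis t) = g t"
proof -
  define G where "G z = g (Arg z)" for z
  have G: "G (cis t) = g t" if "t \<in> {-pi..pi}" for t
  proof (cases "t = -pi")
    case True
    have "cis (-pi) = cis pi" by (simp add: complex_eq_iff)
    then have "G (cis t) = g (Arg (cis pi))" by (simp only: G_def True)
    also have "Arg (cis pi) = pi" by (rule Arg_cis) simp
    finally show ?thesis using True ends by simp
  next
    case False
    then show ?thesis using that by (simp add: G_def Arg_cis)
  qed
  have "closedin (top_of_set (sphere 0 1)) (sphere 0 1 \<inter> G -` C)" if "closed C" for C
  proof -
    have "sphere 0 1 \<inter> G -` C = cis ` ({-pi..pi} \<inter> g -` C)"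
    proof (intro equalityI subsetI)
      fix z assume z: "z \<in> sphere 0 1 \<inter> G -` C"
      have "z \<noteq> 0" using z by auto
      then have "cis (Arg z) = z" using z by (simp add: cis_Arg sgn_eq)
      moreover have "Arg z \<in> {-pi..pi} \<inter> g -` C"
        using z mpi_less_Arg[of z] Arg_le_pi[of z] by (simp add: G_def less_imp_le)
      ultimately show "z \<in> cis ` ({-pi..pi} \<inter> g -` C)" by (metis image_eqI)
    next
      fix z assume "z \<in> cis ` ({-pi..pi} \<inter> g -` C)"
      then show "z \<in> sphere 0 1 \<inter> G -` C" using G by auto
    qed
    moreover have "compact ({-pi..pi} \<inter> g -` C)"
      by (rule closedin_compact[OF compact_Icc continuous_closedin_preimage[OF g that]])
    then have "closed (cis ` ({-pi..pi} \<inter> g -` C))"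
      by (intro compact_imp_closed compact_continuous_image) (auto intro!: continuous_intros)
    ultimately have "closed (sphere 0 1 \<inter> G -` C)" by simp
    then show ?thesis by (auto simp: closedin_closed)
  qed
  then have "continuous_on (sphere 0 1) G"
    by (simp add: continuous_closedin_preimage_eq)
  with G that show thesis by blast
qed

text \<open>
  On the unit circle the coordinates \<open>Re z\<close> and \<open>Im z\<close> are the trigonometric polynomials
  \<open>cos t\<close> and \<open>sin t\<close>, which generate all real polynomial functions. This turns the
  Stone--Weierstrass theorem on the circle into uniform density of trigonometric polynomials.
\<close>
lemma trig_poly_real_polynomial:
  fixes q :: "complex \<Rightarrow> real"
  assumes "real_polynomial_function q"
  shows "trig_poly (\<lambda>t. of_real (q (cis t)))"
  using assms
proof (induction rule: real_polynomial_function.induct)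
  case (linear f)
  interpret bounded_linear f by fact
  have "f (cis t) = Re (harmonic 1 t) * f 1 + Im (harmonic 1 t) * f \<i>" for t
  proof -
    have "cis t = cos t *\<^sub>R 1 + sin t *\<^sub>R \<i>" by (simp add: complex_eq_iff)
    then have "f (cis t) = cos t * f 1 + sin t * f \<i>" by (simp only: add scaleR real_scaleR_def)
    then show ?thesis using harmonic_cis[of 1 t] by simp
  qed
  moreover have "trig_poly (harmonic 1)" using trig_poly_harmonic[of 1 1] by simp
  then have "trig_poly (\<lambda>t. of_real (Re (harmonic 1 t)) * of_real (f 1)
      + of_real (Im (harmonic 1 t)) * of_real (f \<i>))"
    by (intro trig_poly_add trig_poly_mult trig_poly_const trig_poly_Re trig_poly_Im)
  ultimately show ?case by simp
next
  case (const c)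
  show ?case by (rule trig_poly_const)
next
  case (add f g)
  then show ?case using trig_poly_add by simp
next
  case (mult f g)
  then show ?case using trig_poly_mult by simp
qed

lemma trig_poly_uniform_approx_real:
  fixes g :: "real \<Rightarrow> real"
  assumes g: "continuous_on {-pi..pi} g" and ends: "g (-pi) = g pi" and "0 < e"
  obtains u :: "real \<Rightarrow> real" where "trig_poly (\<lambda>t. of_real (u t))"
    "\<And>t. t \<in> {-pi..pi} \<Longrightarrow> \<bar>g t - u t\<bar> < e"
proof -
  obtain G where G: "continuous_on (sphere 0 1) G"
      "\<And>t. t \<in> {-pi..pi} \<Longrightarrow> G (cis t) = complex_of_real (g t)"
    using continuous_on_factor_cis[OF continuous_on_of_real[OF g]] ends by metis
  have "compact (sphere (0::complex) 1)" "continuous_on (sphere 0 1) (\<lambda>z. Re (G z))"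
    by (auto intro!: continuous_intros G)
  then obtain q where q: "real_polynomial_function q"
      "\<And>z. z \<in> sphere 0 1 \<Longrightarrow> \<bar>Re (G z) - q z\<bar> < e"
    using Stone_Weierstrass_real_polynomial_function[OF _ _ \<open>0 < e\<close>] by metis
  show thesis
  proof (rule that)
    show "trig_poly (\<lambda>t. of_real (q (cis t)))" by (rule trig_poly_real_polynomial[OF q(1)])
    show "\<bar>g t - q (cis t)\<bar> < e" if "t \<in> {-pi..pi}" for t
      using q(2)[of "cis t"] G(2)[OF that] by simp
  qed
qed

lemma trig_poly_uniform_approx:
  fixes g :: "real \<Rightarrow> complex"
  assumes g: "continuous_on {-pi..pi} g" and ends: "g (-pi) = g pi" and e: "0 < e"
  obtains T where "trig_poly T" "\<And>t. t \<in> {-pi..pi} \<Longrightarrow> cmod (g t - T t) < e"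
proof -
  obtain u where u: "trig_poly (\<lambda>t. of_real (u t))"
    "\<And>t. t \<in> {-pi..pi} \<Longrightarrow> \<bar>Re (g t) - u t\<bar> < e / 2"
    using trig_poly_uniform_approx_real[of "\<lambda>t. Re (g t)" "e / 2"] g ends e
    by (metis continuous_on_Re half_gt_zero)
  obtain v where v: "trig_poly (\<lambda>t. of_real (v t))"
    "\<And>t. t \<in> {-pi..pi} \<Longrightarrow> \<bar>Im (g t) - v t\<bar> < e / 2"
    using trig_poly_uniform_approx_real[of "\<lambda>t. Im (g t)" "e / 2"] g ends e
    by (metis continuous_on_Im half_gt_zero)
  show thesis
  proof (rule that)
    show "trig_poly (\<lambda>t. of_real (u t) + \<i> * of_real (v t))"
      by (intro trig_poly_add trig_poly_mult trig_poly_const u v)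
    show "cmod (g t - (of_real (u t) + \<i> * of_real (v t))) < e" if "t \<in> {-pi..pi}" for t
      using cmod_le[of "g t - (of_real (u t) + \<i> * of_real (v t))"] u(2)[OF that] v(2)[OF that]
      by simp
  qed
qed

text \<open>
  The radial retraction of the plane onto the disc of radius \<open>M\<close>.
\<close>
definition clip :: "real \<Rightarrow> complex \<Rightarrow> complex" where
  "clip M z = of_real (M / max M (cmod z)) * z"

lemma
  assumes "0 < M"
  shows norm_clip_le: "cmod (clip M z) \<le> M"
    and norm_clip_le_norm: "cmod (clip M z) \<le> cmod z"
    and clip_id: "cmod z \<le> M \<Longrightarrow> clip M z = z"
    and continuous_on_clip: "continuous_on S (clip M)"
proof -
  show "cmod (clip M z) \<le> M" "cmod (clip M z) \<le> cmod z"
    using assms by (auto simp: clip_def norm_mult norm_divide field_simps max_def)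
  show "clip M z = z" if "cmod z \<le> M" using that assms by (simp add: clip_def max_absorb1)
  show "continuous_on S (clip M)"
    unfolding clip_def using assms by (intro continuous_intros) auto
qed

lemma Lp_mass_dominated_convergence:
  assumes "\<And>n. s n \<in> borel_measurable circle" "w \<in> Lp_period p" "0 < p"
    and le: "\<And>n t. t \<in> {-pi..pi} \<Longrightarrow> cmod (s n t) \<le> cmod (w t)"
    and lim: "AE t in circle. (\<lambda>n. s n t) \<longlonglongrightarrow> 0"
  shows "(\<lambda>n. Lp_mass p (s n)) \<longlonglongrightarrow> 0"
proof -
  have "(\<lambda>n. \<integral>t. cmod (s n t) powr p \<partial>circle) \<longlonglongrightarrow> (\<integral>t. 0 \<partial>circle)"
  proof (rule integral_dominated_convergence[where w = "\<lambda>t. cmod (w t) powr p"])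
    show "integrable circle (\<lambda>t. cmod (w t) powr p)" using assms by (simp add: Lp_period_def)
    show "(\<lambda>t. cmod (s n t) powr p) \<in> borel_measurable circle" for n
      using assms(1) by measurable
    show "AE t in circle. (\<lambda>n. cmod (s n t) powr p) \<longlonglongrightarrow> 0"
      using lim
    proof eventually_elim
      case (elim t)
      have "(\<lambda>n. cmod (s n t) powr p) \<longlonglongrightarrow> 0 powr p"
        using elim \<open>0 < p\<close> by (intro tendsto_powr') (auto intro: tendsto_norm_zero)
      then show ?case by simp
    qed
    show "AE t in circle. norm (cmod (s n t) powr p) \<le> cmod (w t) powr p" for n
      using le \<open>0 < p\<close> by (intro AE_I2) (auto intro!: powr_mono2)
  qed auto
  then show ?thesis by (simp add: Lp_mass_def)
qed

text \<open>
  A measurable function is almost everywhere a limit of continuous functions. Clipping these at the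
  bound of \<open>f\<close> provides a dominating constant, and multiplying them by a factor that vanishes at
  both ends of the period makes them continuous on the circle.
\<close>
lemma trig_poly_dense_bounded:
  assumes f: "f \<in> borel_measurable circle" and M: "0 < M" "\<And>t. cmod (f t) \<le> M"
    and "0 < p" "0 < e"
  obtains g where "trig_poly g" "Lp_mass p (\<lambda>t. f t - g t) < e"
proof -
  have "f measurable_on {-pi..pi}"
    using f by (simp add: measurable_on_iff_borel_measurable)
  then obtain N h where N: "negligible N" and h: "\<And>n. continuous_on UNIV (h n)"
    and lim: "\<And>t. t \<notin> N \<Longrightarrow> (\<lambda>n. h n t) \<longlonglongrightarrow> (if t \<in> {-pi..pi} then f t else 0)"
    unfolding measurable_on_def by metis
  \<comment> \<open>the factor is 0 at the ends of the period and tends to 1 inside\<close>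
  define s where "s n t = of_real (1 - ((t / pi)\<^sup>2) ^ n) * clip M (h n t)" for n t
  have cs: "continuous_on {-pi..pi} (s n)" for n
    unfolding s_def
    by (intro continuous_intros continuous_on_compose2[OF continuous_on_clip[OF M(1), of UNIV]]
        continuous_on_subset[OF h]) auto
  have s_le: "cmod (s n t) \<le> M" if "t \<in> {-pi..pi}" for n t
  proof -
    have "\<bar>t\<bar> \<le> pi" using that by auto
    then have "(t / pi)\<^sup>2 \<le> 1" by (simp add: abs_square_le_1)
    then have "((t / pi)\<^sup>2) ^ n \<le> 1" by (simp add: power_le_one)
    moreover have "0 \<le> ((t / pi)\<^sup>2) ^ n" by simp
    ultimately have "\<bar>1 - ((t / pi)\<^sup>2) ^ n\<bar> \<le> 1" by linarith
    then have "cmod (s n t) \<le> 1 * M"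
      unfolding s_def norm_mult norm_of_real by (intro mult_mono norm_clip_le M) auto
    then show ?thesis by simp
  qed
  have s_lim: "(\<lambda>n. s n t) \<longlonglongrightarrow> f t" if "t \<notin> N \<union> {-pi, pi}" "t \<in> {-pi..pi}" for t
  proof -
    have "\<bar>t\<bar> < pi" using that by auto
    then have "\<bar>(t / pi)\<^sup>2\<bar> < 1" by (simp add: abs_square_less_1)
    then have "(\<lambda>n. ((t / pi)\<^sup>2) ^ n) \<longlonglongrightarrow> 0"
      by (intro LIMSEQ_power_zero[of "(t / pi)\<^sup>2"]) (simp only: real_norm_def)
    then have 1: "(\<lambda>n. complex_of_real (1 - ((t / pi)\<^sup>2) ^ n)) \<longlonglongrightarrow> of_real (1 - 0)"
      by (intro tendsto_of_real tendsto_diff tendsto_const)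
    have "isCont (clip M) (f t)"
      using continuous_on_clip[OF M(1), of UNIV] by (simp add: continuous_on_eq_continuous_at)
    then have "(\<lambda>n. clip M (h n t)) \<longlonglongrightarrow> clip M (f t)"
      using lim[of t] that by (intro isCont_tendsto_compose[of _ "clip M"]) auto
    from tendsto_mult[OF 1 this] show ?thesis
      by (simp add: s_def clip_id M)
  qed
  have "(\<lambda>n. Lp_mass p (\<lambda>t. f t - s n t)) \<longlonglongrightarrow> 0"
  proof (rule Lp_mass_dominated_convergence[where w = "\<lambda>t. of_real (2 * M)"])
    have "s n \<in> borel_measurable circle" for n
      by (intro continuous_imp_measurable_on_sets_lebesgue cs) simp
    then show "(\<lambda>t. f t - s n t) \<in> borel_measurable circle" for n
      using f by simp
    show "(\<lambda>t. of_real (2 * M)) \<in> Lp_period p" using \<open>0 < p\<close> by (intro Lp_period_continuous) auto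
    show "cmod (f t - s n t) \<le> cmod (of_real (2 * M))" if "t \<in> {-pi..pi}" for n t
      using norm_triangle_ineq4[of "f t" "s n t"] M(2)[of t] s_le[OF that, of n] M(1) by simp
    have "negligible (N \<union> {-pi, pi})" using N by simp
    then have "AE t in lebesgue. t \<notin> N \<union> {-pi, pi}"
      by (intro AE_not_in) (simp add: negligible_iff_null_sets)
    then have "AE t in circle. t \<notin> N \<union> {-pi, pi}"
      by (subst AE_restrict_space_iff) auto
    moreover have "AE t in circle. t \<in> {-pi..pi}" by (intro AE_I2) simp
    ultimately show "AE t in circle. (\<lambda>n. f t - s n t) \<longlonglongrightarrow> 0"
    proof eventually_elim
      case (elim t)
      from tendsto_diff[OF tendsto_const[of "f t"] s_lim[OF elim]] show ?case by simp
    qed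
  qed fact
  then have "\<forall>\<^sub>F n in sequentially. Lp_mass p (\<lambda>t. f t - s n t) < e / (2 * 2 powr p)"
    using \<open>0 < e\<close> by (intro order_tendstoD) auto
  then obtain n where n: "Lp_mass p (\<lambda>t. f t - s n t) < e / (2 * 2 powr p)"
    by (auto simp: eventually_sequentially)
  have s_ends: "s n (-pi) = s n pi" by (simp add: s_def)
  define d where "d = (e / (2 * 2 powr p) / (4 * pi)) powr (1 / p)"
  have "0 < d" unfolding d_def using \<open>0 < e\<close> by simp
  then obtain g where g: "trig_poly g" "\<And>t. t \<in> {-pi..pi} \<Longrightarrow> cmod (s n t - g t) < d"
    using trig_poly_uniform_approx[OF cs s_ends] by blast
  have fp: "f \<in> Lp_period p" using f M \<open>0 < p\<close> by (intro Lp_period_bounded) auto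
  have sp: "s n \<in> Lp_period p" by (intro Lp_period_continuous cs \<open>0 < p\<close>)
  have gp: "g \<in> Lp_period p" by (intro trig_poly_Lp_period g \<open>0 < p\<close>)
  have "Lp_mass p (\<lambda>t. s n t - g t) \<le> 2 * pi * d powr p"
    using g(2) by (intro Lp_mass_le_bound Lp_period_diff sp gp \<open>0 < p\<close>) (auto intro: less_imp_le)
  also have "\<dots> = e / (2 * 2 powr p) / 2"
    using \<open>0 < p\<close> \<open>0 < e\<close> by (simp add: d_def powr_powr)
  also have "\<dots> < e / (2 * 2 powr p)"
  proof -
    have "x / 2 < x" if "0 < x" for x :: real using that by simp
    then show ?thesis using \<open>0 < e\<close> by (metis divide_pos_pos mult_pos_pos powr_gt_zero zero_less_numeral zero_neq_numeral)
  qed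
  finally have sg: "Lp_mass p (\<lambda>t. s n t - g t) < e / (2 * 2 powr p)" .
  have "Lp_mass p (\<lambda>t. (f t - s n t) + (s n t - g t))
      \<le> 2 powr p * (Lp_mass p (\<lambda>t. f t - s n t) + Lp_mass p (\<lambda>t. s n t - g t))"
    by (intro Lp_mass_add Lp_period_diff fp sp gp \<open>0 < p\<close>)
  also have "\<dots> < 2 powr p * (e / (2 * 2 powr p) + e / (2 * 2 powr p))"
    using n sg by (intro mult_strict_left_mono add_strict_mono) auto
  also have "\<dots> = e" by simp
  finally show thesis using g(1) that by simp
qed

text \<open>
  The truncations of \<open>f\<close> are eventually equal to \<open>f\<close> at every point and dominated by it, which
  reduces the claim to bounded functions.
\<close>
lemma trig_poly_dense:
  assumes f: "f \<in> Lp_period p" and "0 < p" "0 < e"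
  obtains g where "trig_poly g" "Lp_mass p (\<lambda>t. f t - g t) < e"
proof -
  have m: "f \<in> borel_measurable circle" using f by (simp add: Lp_period_def)
  define F where "F n t = clip (real (Suc n)) (f t)" for n t
  have Fm: "F n \<in> borel_measurable circle" for n
    unfolding F_def
    by (rule measurable_compose[OF m]) (intro borel_measurable_continuous_onI continuous_on_clip, simp)
  have F_le: "cmod (F n t) \<le> cmod (f t)" for n t
    unfolding F_def by (intro norm_clip_le_norm) simp
  have Fp: "F n \<in> Lp_period p" for n
    unfolding F_def using Fm[unfolded F_def] \<open>0 < p\<close> norm_clip_le[of "real (Suc n)"]
    by (intro Lp_period_bounded[where B = "real (Suc n)"]) auto
  have "(\<lambda>n. Lp_mass p (\<lambda>t. f t - F n t)) \<longlonglongrightarrow> 0"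
  proof (rule Lp_mass_dominated_convergence[where w = "\<lambda>t. 2 * f t"])
    show "(\<lambda>t. f t - F n t) \<in> borel_measurable circle" for n using m Fm by simp
    show "cmod (f t - F n t) \<le> cmod (2 * f t)" for n t
      using norm_triangle_ineq4[of "f t" "F n t"] F_le[of n t] by (simp add: norm_mult)
    show "AE t in circle. (\<lambda>n. f t - F n t) \<longlonglongrightarrow> 0"
    proof (intro AE_I2 tendsto_eventually)
      fix t
      obtain k where k: "cmod (f t) \<le> real k" using real_arch_simple by blast
      have "F n t = f t" if "k \<le> n" for n
        unfolding F_def using k that by (intro clip_id) auto
      then show "\<forall>\<^sub>F n in sequentially. f t - F n t = 0"
        by (intro eventually_sequentiallyI[of k]) simp
    qed
  qed (use f \<open>0 < p\<close> Lp_period_mult in auto)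
  then have "\<forall>\<^sub>F n in sequentially. Lp_mass p (\<lambda>t. f t - F n t) < e / (2 * 2 powr p)"
    using \<open>0 < e\<close> by (intro order_tendstoD) auto
  then obtain n where n: "Lp_mass p (\<lambda>t. f t - F n t) < e / (2 * 2 powr p)"
    by (auto simp: eventually_sequentially)
  obtain g where g: "trig_poly g" "Lp_mass p (\<lambda>t. F n t - g t) < e / (2 * 2 powr p)"
    using trig_poly_dense_bounded[of "F n" "real (Suc n)" p "e / (2 * 2 powr p)"] Fm
      norm_clip_le[of "real (Suc n)"] \<open>0 < p\<close> \<open>0 < e\<close>
    by (auto simp: F_def)
  have gp: "g \<in> Lp_period p" by (intro trig_poly_Lp_period g \<open>0 < p\<close>)
  have "Lp_mass p (\<lambda>t. (f t - F n t) + (F n t - g t))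
      \<le> 2 powr p * (Lp_mass p (\<lambda>t. f t - F n t) + Lp_mass p (\<lambda>t. F n t - g t))"
    by (intro Lp_mass_add Lp_period_diff f Fp gp \<open>0 < p\<close>)
  also have "\<dots> < 2 powr p * (e / (2 * 2 powr p) + e / (2 * 2 powr p))"
    using n g(2) by (intro mult_strict_left_mono add_strict_mono) auto
  also have "\<dots> = e" by simp
  finally show thesis using g(1) that by simp
qed

section \<open>Analytic functions in the right half-plane\<close>

text \<open>
  This is where \<open>1 < p \<le> 2\<close> enters. When \<open>\<bar>x\<bar>\<close> approaches \<open>pi / 2\<close>, the first term vanishes, but
  \<open>\<bar>p * x\<bar>\<close> approaches \<open>p * pi / 2\<close>, which lies above \<open>pi / 2\<close> and at most at \<open>pi\<close>, so
  \<open>- cos (p * x)\<close> is bounded below by a positive constant; \<open>B\<close> is chosen for this region. In the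
  remaining compact region \<open>cos x\<close> is bounded below, and a large \<open>A\<close> compensates for \<open>B\<close>.
\<close>
lemma cos_powr_inequality:
  fixes p :: real
  assumes "1 < p" "p \<le> 2"
  obtains A B where "0 \<le> A" "0 < B"
    "\<And>x. \<bar>x\<bar> < pi / 2 \<Longrightarrow> 1 \<le> A * cos x powr p - B * cos (p * x)"
proof -
  \<comment> \<open>the midpoint between the zero pi / (2 p) of cos (p x) and the end pi / 2\<close>
  define x0 where "x0 = (pi / 2 + pi / (2 * p)) / 2"
  have "pi / (2 * p) < pi / 2" "0 < pi / (2 * p)" using assms by (auto simp: field_simps)
  then have x0: "0 < x0" "x0 < pi / 2" by (auto simp: x0_def)
  have "pi < p * pi" "p * pi \<le> 2 * pi" using assms by auto
  moreover have "4 * (p * x0) = p * pi + pi" using assms by (simp add: x0_def field_simps)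
  ultimately have px0: "pi / 2 < p * x0" "p * x0 < pi" using pi_gt_zero by linarith+
  have c1: "cos (p * x0) < 0"
  proof -
    have "cos (p * x0) < cos (pi / 2)" using px0 by (intro cos_monotone_0_pi) auto
    then show ?thesis by simp
  qed
  define B where "B = - 1 / cos (p * x0)"
  have "0 < B" using c1 by (simp add: B_def divide_neg_neg)
  have c0: "0 < cos x0" using x0 by (intro cos_gt_zero_pi) auto
  define A where "A = (1 + B) / cos x0 powr p"
  have "0 \<le> A" using \<open>0 < B\<close> by (simp add: A_def)
  have "1 \<le> A * cos x powr p - B * cos (p * x)" if x: "\<bar>x\<bar> < pi / 2" for x
  proof (cases "\<bar>x\<bar> \<le> x0")
    case True
    have "cos x0 \<le> cos \<bar>x\<bar>" using True x0 by (intro cos_monotone_0_pi_le) auto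
    then have "cos x0 \<le> cos x" by simp
    then have "A * cos x0 powr p \<le> A * cos x powr p"
      using c0 assms \<open>0 \<le> A\<close> by (intro mult_left_mono powr_mono2) auto
    moreover have "A * cos x0 powr p = 1 + B" using c0 by (simp add: A_def)
    moreover have "B * cos (p * x) \<le> B * 1" using \<open>0 < B\<close> by (intro mult_left_mono) auto
    ultimately show ?thesis by linarith
  next
    case False
    have "p * \<bar>x\<bar> \<le> 2 * (pi / 2)" using assms x by (intro mult_mono) auto
    moreover have "p * x0 \<le> p * \<bar>x\<bar>" using False assms by simp
    ultimately have "cos (p * \<bar>x\<bar>) \<le> cos (p * x0)"
      using px0 by (intro cos_monotone_0_pi_le) auto
    moreover have "cos (p * x) = cos (p * \<bar>x\<bar>)" by (cases "x \<ge> 0") auto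
    ultimately have "B * cos (p * x) \<le> B * cos (p * x0)" using \<open>0 < B\<close> by simp
    also have "\<dots> = -1" using c1 by (simp add: B_def)
    finally have "1 \<le> - (B * cos (p * x))" by simp
    moreover have "0 \<le> A * cos x powr p" using \<open>0 \<le> A\<close> by simp
    ultimately show ?thesis by linarith
  qed
  with \<open>0 \<le> A\<close> \<open>0 < B\<close> that show thesis by blast
qed

text \<open>
  The previous inequality in polar form. It bounds the modulus of an analytic function in the right
  half-plane by its real part and a harmonic correction.
\<close>
lemma norm_powr_le_Re:
  fixes p :: real
  assumes "1 < p" "p \<le> 2"
  obtains A B where "0 \<le> A" "0 < B"
    "\<And>z. 0 < Re z \<Longrightarrow> cmod z powr p \<le> A * Re z powr p - B * Re (z powr of_real p)"
proof -
  obtain A B where AB: "0 \<le> A" "0 < B"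
    and le: "\<And>x. \<bar>x\<bar> < pi / 2 \<Longrightarrow> 1 \<le> A * cos x powr p - B * cos (p * x)"
    using cos_powr_inequality[OF assms] by blast
  have "cmod z powr p \<le> A * Re z powr p - B * Re (z powr of_real p)" if "0 < Re z" for z
  proof -
    have z: "z \<noteq> 0" using that by auto
    have arg: "\<bar>Arg z\<bar> < pi / 2" using Re_Ln_pos_lt[OF z] that z by (simp add: Arg_eq_Im_Ln)
    have "Re z = cmod z * cos (Arg z)"
      using rcis_cmod_Arg[of z] by (metis Re_rcis)
    then have 1: "Re z powr p = cmod z powr p * cos (Arg z) powr p"
      using cos_gt_zero_pi[of "Arg z"] arg by (simp add: powr_mult)
    have 2: "Re (z powr of_real p) = cmod z powr p * cos (p * Arg z)"
      using z by (simp add: powr_def Re_exp Arg_eq_Im_Ln)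
    have "cmod z powr p * 1 \<le> cmod z powr p * (A * cos (Arg z) powr p - B * cos (p * Arg z))"
      by (intro mult_left_mono le arg) simp
    then show ?thesis by (simp add: 1 2 algebra_simps)
  qed
  with AB that show thesis by blast
qed

text \<open>
  Cauchy's formula parametrises the circle over \<open>[0, 2\<pi>]\<close>. Applying it to \<open>h (- z)\<close>, that is after a
  rotation by \<open>\<pi>\<close>, gives the integral over \<open>[-\<pi>, \<pi>]\<close> without splitting the period.
\<close>
lemma has_integral_mean_value_disc:
  fixes h :: "complex \<Rightarrow> complex"
  assumes "continuous_on (cball 0 1) h" "h holomorphic_on ball 0 1"
  shows "((\<lambda>t. h (cis t)) has_integral (2 * pi * h 0)) {-pi..pi}"
proof -
  define k where "k z = h (- z)" for z
  have ck: "continuous_on (cball 0 1) k"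
    unfolding k_def by (rule continuous_on_compose2[OF assms(1)]) (auto intro!: continuous_intros)
  have "(h \<circ> uminus) holomorphic_on ball 0 1"
    by (rule holomorphic_on_compose_gen[OF _ assms(2)]) (auto intro!: holomorphic_intros)
  then have hk: "k holomorphic_on ball 0 1" by (simp add: k_def[abs_def] o_def)
  have "((\<lambda>u. k u / (u - 0)) has_contour_integral (2 * of_real pi * \<i> * k 0)) (circlepath 0 1)"
    by (rule Cauchy_integral_circlepath[OF ck hk]) simp
  then have "((\<lambda>t. k (cis t) / cis t * \<i> * cis t) has_integral (2 * of_real pi * \<i> * k 0)) {0..2 * pi}"
    by (simp add: circlepath_def has_contour_integral_part_circlepath_iff)
  then have "((\<lambda>t. - \<i> * (k (cis t) / cis t * \<i> * cis t))
      has_integral (- \<i> * (2 * of_real pi * \<i> * k 0))) {0..2 * pi}"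
    by (rule has_integral_mult_right)
  moreover have "- \<i> * (k (cis t) / cis t * \<i> * cis t) = k (cis t)" for t
    by (simp add: field_simps)
  moreover have "- \<i> * (2 * of_real pi * \<i> * k 0) = 2 * pi * k 0"
    by (simp add: field_simps)
  ultimately have "((\<lambda>t. k (cis t)) has_integral (2 * pi * k 0)) {0..2 * pi}" by (simp only:)
  from has_integral_shift_real_ivl[OF this, of pi]
  have "((\<lambda>t. k (cis (t + pi))) has_integral (2 * pi * k 0)) {-pi..pi}" by simp
  moreover have "k (cis (t + pi)) = h (cis t)" for t
    by (simp add: k_def flip: cis_mult)
  ultimately show ?thesis by (simp add: k_def)
qed

text \<open>
  The minimum principle for the harmonic function \<open>Re F\<close>, obtained from the maximum modulus
  principle for \<open>exp (- F)\<close>.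
\<close>
lemma Re_ge_disc:
  assumes F: "F holomorphic_on UNIV" and d: "\<And>z. cmod z = 1 \<Longrightarrow> d \<le> Re (F z)"
    and z: "cmod z \<le> 1"
  shows "d \<le> Re (F z)"
proof -
  have "(\<lambda>w. exp (- F w)) holomorphic_on UNIV"
    by (intro holomorphic_intros F)
  then have h: "(\<lambda>w. exp (- F w)) holomorphic_on S" for S
    by (rule holomorphic_on_subset) simp
  have "cmod (exp (- F z)) \<le> exp (- d)"
    by (rule maximum_modulus_frontier[where S = "cball 0 1" and f = "\<lambda>w. exp (- F w)"])
      (use z d h holomorphic_on_imp_continuous_on[OF h] in auto)
  then show ?thesis by simp
qed

text \<open>
  The heart of the matter. Since \<open>F\<close> takes values in the right half-plane, the power \<open>F powr p\<close> is
  again holomorphic, so the mean of \<open>Re (F powr p)\<close> over the circle is its value at \<open>0\<close>. As \<open>F 0\<close> is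
  positive, that value is \<open>(F 0) powr p \<ge> 0\<close>. Integrating the pointwise inequality of
  \<open>norm_powr_le_Re\<close> therefore bounds \<open>F\<close>, and simultaneously \<open>F 0\<close>, by \<open>Re F\<close>.
\<close>
lemma Lp_mass_analytic_le_Re:
  fixes p :: real
  assumes p: "1 < p" "p \<le> 2"
  obtains C where "0 \<le> C"
    "\<And>F d. \<lbrakk>F holomorphic_on UNIV; 0 < d; \<And>z. cmod z = 1 \<Longrightarrow> d \<le> Re (F z); Im (F 0) = 0\<rbrakk>
      \<Longrightarrow> Lp_mass p (\<lambda>t. F (cis t)) \<le> C * Lp_mass p (\<lambda>t. of_real (Re (F (cis t))))
        \<and> Lp_mass p (\<lambda>t. F 0) \<le> C * Lp_mass p (\<lambda>t. of_real (Re (F (cis t))))"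
proof -
  obtain A B where AB: "0 \<le> A" "0 < B"
    and le: "\<And>z. 0 < Re z \<Longrightarrow> cmod z powr p \<le> A * Re z powr p - B * Re (z powr of_real p)"
    using norm_powr_le_Re[OF p] by blast
  show thesis
  proof (rule that[of "max A (A / B)"])
    show "0 \<le> max A (A / B)" using AB by simp
  next
    fix F :: "complex \<Rightarrow> complex" and d :: real
    assume F: "F holomorphic_on UNIV" and "0 < d" and d: "\<And>z. cmod z = 1 \<Longrightarrow> d \<le> Re (F z)"
      and F0: "Im (F 0) = 0"
    let ?m = "Lp_mass p (\<lambda>t. of_real (Re (F (cis t))))"
    have pos: "0 < Re (F z)" if "cmod z \<le> 1" for z
      using Re_ge_disc[OF F d that] \<open>0 < d\<close> by simp
    have cF: "continuous_on S F" for S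
      using holomorphic_on_imp_continuous_on[OF F] continuous_on_subset by blast
    have hF: "F holomorphic_on S" for S
      using F by (rule holomorphic_on_subset) simp
    have cc: "continuous_on {-pi..pi} (\<lambda>t. F (cis t))"
      by (rule continuous_on_compose2[OF cF[of UNIV]]) (auto intro!: continuous_intros)
    have nonneg_Reals: "F z \<notin> \<real>\<^sub>\<le>\<^sub>0" if "cmod z \<le> 1" for z
      using pos[OF that] by (auto simp: complex_nonpos_Reals_iff)
    define G where "G z = F z powr of_real p" for z
    have cG: "continuous_on (cball 0 1) G"
      unfolding G_def using pos p
      by (intro continuous_on_powr_complex cF continuous_on_const) (auto simp: less_imp_le)
    have "G holomorphic_on ball 0 1"
      unfolding G_def using nonneg_Reals by (intro holomorphic_intros hF) auto
    then have G_int: "((\<lambda>t. G (cis t)) has_integral (2 * pi * G 0)) {-pi..pi}"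
      by (intro has_integral_mean_value_disc cG)
    have cGc: "continuous_on {-pi..pi} (\<lambda>t. Re (G (cis t)))"
      by (intro continuous_intros continuous_on_compose2[OF cG]) auto
    have ReG: "(\<integral>t. Re (G (cis t)) \<partial>circle) = 2 * pi * Re (G 0)"
    proof -
      have "((\<lambda>t. Re (G (cis t))) has_integral Re (2 * pi * G 0)) {-pi..pi}"
        using has_integral_linear[OF G_int bounded_linear_Re] by (simp add: o_def)
      then have "integral {-pi..pi} (\<lambda>t. Re (G (cis t))) = 2 * pi * Re (G 0)"
        by (simp add: integral_unique)
      moreover have "(\<integral>t. Re (G (cis t)) \<partial>circle) = integral {-pi..pi} (\<lambda>t. Re (G (cis t)))"
        by (intro lebesgue_integral_eq_integral continuous_imp_integrable_real cGc) auto
      ultimately show ?thesis by simp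
    qed
    have "F 0 = of_real (Re (F 0))" using F0 by (simp add: complex_eq_iff)
    then have G0: "Re (G 0) = cmod (F 0) powr p"
      using pos[of 0] F0 unfolding G_def
      by (metis Re_complex_of_real norm_of_real norm_zero powr_of_real less_imp_le abs_of_nonneg zero_le_one)
    have i1: "integrable circle (\<lambda>t. cmod (F (cis t)) powr p)"
      using Lp_period_continuous[OF cc, of p] p by (simp add: Lp_period_def)
    have i2: "integrable circle (\<lambda>t. cmod (of_real (Re (F (cis t)))) powr p)"
      using Lp_period_continuous[OF continuous_on_of_real[OF continuous_on_Re[OF cc]], of p] p
      by (simp add: Lp_period_def)
    have i3: "integrable circle (\<lambda>t. Re (G (cis t)))"
      by (intro continuous_imp_integrable_real cGc)
    have "Lp_mass p (\<lambda>t. F (cis t))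
        \<le> (\<integral>t. A * cmod (of_real (Re (F (cis t)))) powr p - B * Re (G (cis t)) \<partial>circle)"
      unfolding Lp_mass_def
    proof (intro integral_mono i1)
      show "cmod (F (cis t)) powr p
          \<le> A * cmod (of_real (Re (F (cis t)))) powr p - B * Re (G (cis t))" for t
        using le[OF pos[of "cis t"]] pos[of "cis t"] by (simp add: G_def)
    qed (use i2 i3 in auto)
    also have "\<dots> = A * ?m - B * Lp_mass p (\<lambda>t. F 0)"
      using i2 i3 by (simp add: Lp_mass_def[of p "\<lambda>t. of_real (Re (F (cis t)))"] ReG Lp_mass_const G0)
    finally have *: "Lp_mass p (\<lambda>t. F (cis t)) + B * Lp_mass p (\<lambda>t. F 0) \<le> A * ?m" by simp
    have "0 \<le> B * Lp_mass p (\<lambda>t. F 0)" using AB by (simp add: Lp_mass_nonneg)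
    then have "Lp_mass p (\<lambda>t. F (cis t)) \<le> A * ?m" using * by linarith
    also have "\<dots> \<le> max A (A / B) * ?m" by (intro mult_right_mono Lp_mass_nonneg) simp
    finally have 1: "Lp_mass p (\<lambda>t. F (cis t)) \<le> max A (A / B) * ?m" .
    have "B * Lp_mass p (\<lambda>t. F 0) \<le> A * ?m" using * Lp_mass_nonneg[of p "\<lambda>t. F (cis t)"] by linarith
    then have "Lp_mass p (\<lambda>t. F 0) \<le> A / B * ?m" using AB by (simp add: field_simps)
    also have "\<dots> \<le> max A (A / B) * ?m" by (intro mult_right_mono Lp_mass_nonneg) simp
    finally have 2: "Lp_mass p (\<lambda>t. F 0) \<le> max A (A / B) * ?m" .
    from 1 2 show "Lp_mass p (\<lambda>t. F (cis t)) \<le> max A (A / B) * ?m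
        \<and> Lp_mass p (\<lambda>t. F 0) \<le> max A (A / B) * ?m" ..
  qed
qed

section \<open>The Riesz projection\<close>

text \<open>
  On trigonometric polynomials of degree at most \<open>N\<close> this is the Riesz projection onto the
  nonnegative frequencies. The truncation makes it a finite sum for every \<open>f\<close>; the constants
  below do not depend on \<open>N\<close>.
\<close>
definition riesz_proj :: "nat \<Rightarrow> (real \<Rightarrow> complex) \<Rightarrow> real \<Rightarrow> complex" where
  "riesz_proj N f t = (\<Sum>k\<le>N. fourier_coeff f (int k) * harmonic (int k) t)"

lemma riesz_proj_add:
  assumes "integrable circle f" "integrable circle g"
  shows "riesz_proj N (\<lambda>t. f t + g t) t = riesz_proj N f t + riesz_proj N g t"
  by (simp add: riesz_proj_def fourier_coeff_add[OF assms] distrib_right sum.distrib)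

lemma riesz_proj_mult: "riesz_proj N (\<lambda>t. c * f t) t = c * riesz_proj N f t"
  by (simp add: riesz_proj_def fourier_coeff_mult sum_distrib_left mult.assoc)

lemma riesz_proj_Lp_period: "0 < p \<Longrightarrow> riesz_proj N f \<in> Lp_period p"
  unfolding riesz_proj_def[abs_def] by (intro Lp_period_continuous continuous_intros)

lemma sum_int_symmetric:
  fixes g :: "int \<Rightarrow> 'a::comm_monoid_add"
  shows "(\<Sum>j = - int N..int N. g j) = g 0 + (\<Sum>k=1..N. g (int k) + g (- int k))"
proof (induction N)
  case (Suc N)
  have "{- int (Suc N)..int (Suc N)} = insert (int (Suc N)) (insert (- int (Suc N)) {- int N..int N})"
    by auto
  then have "(\<Sum>j = - int (Suc N)..int (Suc N). g j)
      = g (int (Suc N)) + (g (- int (Suc N)) + (\<Sum>j = - int N..int N. g j))"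
    by simp
  then show ?case by (simp add: Suc.IH ac_simps)
qed simp

text \<open>
  For real \<open>u\<close> the coefficients at \<open>k\<close> and \<open>- k\<close> are conjugate, so \<open>u\<close> is the real part on the circle
  of the polynomial \<open>F\<close> with coefficients \<open>c 0\<close> and \<open>2 * c k\<close>. The projection of \<open>u\<close> is the average of
  \<open>F\<close> and \<open>F 0\<close>, and positivity of \<open>u\<close> places \<open>F\<close> in the right half-plane.
\<close>
lemma riesz_proj_bound_positive:
  fixes p :: real
  assumes p: "1 < p" "p \<le> 2"
  obtains C where "0 \<le> C"
    "\<And>u :: real \<Rightarrow> real. \<And>N d. \<lbrakk>0 < d; \<And>t. t \<in> {-pi..pi} \<Longrightarrow> d \<le> u t;
        \<And>t. fourier_sum N (\<lambda>t. of_real (u t)) t = of_real (u t)\<rbrakk>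
      \<Longrightarrow> Lp_mass p (riesz_proj N (\<lambda>t. of_real (u t))) \<le> C * Lp_mass p (\<lambda>t. of_real (u t))"
proof -
  obtain C where "0 \<le> C" and C:
    "\<And>F d. \<lbrakk>F holomorphic_on UNIV; 0 < d; \<And>z. cmod z = 1 \<Longrightarrow> d \<le> Re (F z); Im (F 0) = 0\<rbrakk>
      \<Longrightarrow> Lp_mass p (\<lambda>t. F (cis t)) \<le> C * Lp_mass p (\<lambda>t. of_real (Re (F (cis t))))
        \<and> Lp_mass p (\<lambda>t. F 0) \<le> C * Lp_mass p (\<lambda>t. of_real (Re (F (cis t))))"
    using Lp_mass_analytic_le_Re[OF p] by metis
  show thesis
  proof (rule that[of "2 * C"])
    show "0 \<le> 2 * C" using \<open>0 \<le> C\<close> by simp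
  next
    fix u :: "real \<Rightarrow> real" and N :: nat and d :: real
    assume "0 < d" and d: "\<And>t. t \<in> {-pi..pi} \<Longrightarrow> d \<le> u t"
      and u: "\<And>t. fourier_sum N (\<lambda>t. of_real (u t)) t = of_real (u t)"
    define c where "c = fourier_coeff (\<lambda>t. of_real (u t))"
    have c_neg: "c (- k) = cnj (c k)" for k
      by (simp add: c_def fourier_coeff_real)
    define F where "F z = c 0 + 2 * (\<Sum>k=1..N. c (int k) * z ^ k)" for z
    have F0: "F 0 = c 0" by (simp add: F_def power_0_left)
    have Re_F: "Re (F (cis t)) = u t" for t
    proof -
      have "complex_of_real (u t) = c 0 + (\<Sum>k=1..N. c (int k) * harmonic (int k) t
          + c (- int k) * harmonic (- int k) t)"
        unfolding u[of t, symmetric] fourier_sum_eq sum_int_symmetric by (simp add: c_def)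
      also have "\<dots> = c 0 + (\<Sum>k=1..N. of_real (2 * Re (c (int k) * cis t ^ k)))"
        by (simp only: c_neg cnj_harmonic[symmetric] complex_cnj_mult[symmetric] complex_add_cnj
            harmonic_cis)
      finally have "Re (of_real (u t))
          = Re (c 0 + (\<Sum>k=1..N. of_real (2 * Re (c (int k) * cis t ^ k))))" by (rule arg_cong)
      then have "u t = Re (c 0) + (\<Sum>k=1..N. 2 * Re (c (int k) * cis t ^ k))" by simp
      also have "\<dots> = Re (F (cis t))" by (simp add: F_def sum_distrib_left)
      finally show ?thesis by simp
    qed
    have holo: "F holomorphic_on UNIV" unfolding F_def by (intro holomorphic_intros)
    have "d \<le> Re (F z)" if "cmod z = 1" for z
    proof -
      have "z \<noteq> 0" using that by auto
      then have z: "cis (Arg z) = z" using that by (simp add: cis_Arg sgn_eq)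
      have "d \<le> u (Arg z)"
        using mpi_less_Arg[of z] Arg_le_pi[of z] by (intro d) simp
      then show ?thesis using Re_F[of "Arg z"] z by simp
    qed
    moreover have "Im (F 0) = 0"
      using c_neg[of 0] F0 by (simp add: complex_eq_iff)
    ultimately have
      1: "Lp_mass p (\<lambda>t. F (cis t)) \<le> C * Lp_mass p (\<lambda>t. of_real (u t))" and
      2: "Lp_mass p (\<lambda>t. F 0) \<le> C * Lp_mass p (\<lambda>t. of_real (u t))"
      using C[OF holo \<open>0 < d\<close>] by (simp_all add: Re_F)
    have proj: "riesz_proj N (\<lambda>t. of_real (u t)) t = 1 / 2 * (F (cis t) + F 0)" for t
    proof -
      have "riesz_proj N (\<lambda>t. of_real (u t)) t = (\<Sum>k\<le>N. c (int k) * cis t ^ k)"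
        by (simp add: riesz_proj_def c_def harmonic_cis)
      also have "\<dots> = c 0 + (\<Sum>k=1..N. c (int k) * cis t ^ k)"
        by (simp add: atMost_atLeast0 sum.atLeast_Suc_atMost)
      finally show ?thesis by (simp add: F0) (simp add: F_def)
    qed
    have Fp: "(\<lambda>t. F (cis t)) \<in> Lp_period p" "(\<lambda>t. F 0) \<in> Lp_period p"
      unfolding F_def using p by (intro Lp_period_continuous continuous_intros; simp)+
    have "Lp_mass p (riesz_proj N (\<lambda>t. of_real (u t)))
        = (1 / 2) powr p * Lp_mass p (\<lambda>t. F (cis t) + F 0)"
      unfolding proj[abs_def] Lp_mass_mult by (simp add: norm_divide)
    also have "\<dots> \<le> (1 / 2) powr p * (2 powr p * (Lp_mass p (\<lambda>t. F (cis t)) + Lp_mass p (\<lambda>t. F 0)))"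
      using p by (intro mult_left_mono Lp_mass_add Fp) auto
    also have "\<dots> = Lp_mass p (\<lambda>t. F (cis t)) + Lp_mass p (\<lambda>t. F 0)"
      by (simp add: powr_divide)
    also have "\<dots> \<le> 2 * C * Lp_mass p (\<lambda>t. of_real (u t))" using 1 2 by linarith
    finally show "Lp_mass p (riesz_proj N (\<lambda>t. of_real (u t)))
        \<le> 2 * C * Lp_mass p (\<lambda>t. of_real (u t))" .
  qed
qed

text \<open>
  Positivity is removed by a decomposition that stays within trigonometric polynomials: if \<open>u\<close>
  approximates \<open>\<bar>f\<bar> + 2 * d\<close> up to \<open>d\<close>, then \<open>u\<close>, \<open>u + Re f\<close> and \<open>u + Im f\<close> are positive
  trigonometric polynomials of size at most \<open>2 * \<bar>f\<bar> + 3 * d\<close>, and \<open>f\<close> is a linear combination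
  of them. The error \<open>\<epsilon>\<close> remains because the degree of \<open>u\<close>, and with it the threshold for
  \<open>N\<close>, may grow as \<open>\<epsilon>\<close> decreases.
\<close>
lemma riesz_proj_bound_trig_poly:
  fixes p :: real
  assumes p: "1 < p" "p \<le> 2"
  obtains C where "0 \<le> C"
    "\<And>f \<epsilon>. \<lbrakk>trig_poly f; 0 < \<epsilon>\<rbrakk>
      \<Longrightarrow> \<forall>\<^sub>F N in sequentially. Lp_mass p (riesz_proj N f) \<le> C * (Lp_mass p f + \<epsilon>)"
proof -
  obtain C where C: "0 \<le> C"
    "\<And>u :: real \<Rightarrow> real. \<And>N d. \<lbrakk>0 < d; \<And>t. t \<in> {-pi..pi} \<Longrightarrow> d \<le> u t;
        \<And>t. fourier_sum N (\<lambda>t. of_real (u t)) t = of_real (u t)\<rbrakk>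
      \<Longrightarrow> Lp_mass p (riesz_proj N (\<lambda>t. of_real (u t))) \<le> C * Lp_mass p (\<lambda>t. of_real (u t))"
    using riesz_proj_bound_positive[OF p] by metis
  define K where "K = 2 powr p * (2 powr p + 2 * pi * 3 powr p)"
  have "0 \<le> K" by (simp add: K_def)
  have p0: "0 < p" using p by simp
  show thesis
  proof (rule that[of "2 powr p * (2 powr p * (C * K + C * K) + 2 powr p * (C * K))"])
    show "0 \<le> 2 powr p * (2 powr p * (C * K + C * K) + 2 powr p * (C * K))"
      using C(1) \<open>0 \<le> K\<close> by (intro mult_nonneg_nonneg add_nonneg_nonneg) auto
  next
    fix f and \<epsilon> :: real assume f: "trig_poly f" and "0 < \<epsilon>"
    define d where "d = \<epsilon> powr (1 / p)"
    have "0 < d" and d_powr: "d powr p = \<epsilon>" using \<open>0 < \<epsilon>\<close> p0 by (auto simp: d_def powr_powr)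
    have "continuous_on {-pi..pi} (\<lambda>t. cmod (f t) + 2 * d)"
      by (intro continuous_intros continuous_on_trig_poly f)
    then obtain u where u: "trig_poly (\<lambda>t. of_real (u t))"
      and u_approx: "\<And>t. t \<in> {-pi..pi} \<Longrightarrow> \<bar>(cmod (f t) + 2 * d) - u t\<bar> < d"
      using trig_poly_uniform_approx_real[of "\<lambda>t. cmod (f t) + 2 * d" d] \<open>0 < d\<close>
        trig_poly_ends[OF f] by metis
    define v where "v = (\<lambda>t. u t + Re (f t))"
    define w where "w = (\<lambda>t. u t + Im (f t))"
    have v: "trig_poly (\<lambda>t. of_real (v t))" and w: "trig_poly (\<lambda>t. of_real (w t))"
      using trig_poly_add[OF u trig_poly_Re[OF f]] trig_poly_add[OF u trig_poly_Im[OF f]]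
      by (simp_all add: v_def w_def)
    have ge: "d \<le> u t" "d \<le> v t" "d \<le> w t"
      and le: "u t \<le> 2 * cmod (f t) + 3 * d" "v t \<le> 2 * cmod (f t) + 3 * d"
        "w t \<le> 2 * cmod (f t) + 3 * d"
      if "t \<in> {-pi..pi}" for t
      using u_approx[OF that] abs_Re_le_cmod[of "f t"] abs_Im_le_cmod[of "f t"] \<open>0 < d\<close>
      unfolding v_def w_def by linarith+
    have fp: "f \<in> Lp_period p" by (rule trig_poly_Lp_period[OF f p0])
    have K: "Lp_mass p (\<lambda>t. of_real (x t)) \<le> K * (Lp_mass p f + \<epsilon>)"
      if x: "trig_poly (\<lambda>t. of_real (x t))" "\<And>t. t \<in> {-pi..pi} \<Longrightarrow> d \<le> x t"
        "\<And>t. t \<in> {-pi..pi} \<Longrightarrow> x t \<le> 2 * cmod (f t) + 3 * d" for x :: "real \<Rightarrow> real"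
    proof -
      define f2 where "f2 = (\<lambda>t. complex_of_real (2 * cmod (f t)))"
      have f2p: "f2 \<in> Lp_period p"
        unfolding f2_def using p0 by (intro Lp_period_continuous continuous_intros continuous_on_trig_poly f)
      have cp: "(\<lambda>t. complex_of_real (3 * d)) \<in> Lp_period p"
        using p0 by (intro Lp_period_continuous continuous_intros)
      have "Lp_mass p (\<lambda>t. of_real (x t)) \<le> Lp_mass p (\<lambda>t. f2 t + of_real (3 * d))"
      proof (rule Lp_mass_mono[OF trig_poly_Lp_period[OF x(1) p0] Lp_period_add[OF f2p cp p0] p0])
        fix t assume t: "t \<in> {-pi..pi}"
        have "f2 t + of_real (3 * d) = of_real (2 * cmod (f t) + 3 * d)" by (simp add: f2_def)
        then have "cmod (f2 t + of_real (3 * d)) = 2 * cmod (f t) + 3 * d"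
          using \<open>0 < d\<close> by (simp only: norm_of_real) simp
        then show "cmod (of_real (x t)) \<le> cmod (f2 t + of_real (3 * d))"
          using x(2,3)[OF t] \<open>0 < d\<close> by simp
      qed
      also have "\<dots> \<le> 2 powr p * (Lp_mass p f2 + Lp_mass p (\<lambda>t. of_real (3 * d)))"
        by (intro Lp_mass_add f2p cp p0)
      also have "Lp_mass p f2 = 2 powr p * Lp_mass p f"
        by (simp add: Lp_mass_def f2_def powr_mult)
      also have "Lp_mass p (\<lambda>t. of_real (3 * d)) = 2 * pi * 3 powr p * \<epsilon>"
        using \<open>0 < d\<close> unfolding Lp_mass_const by (simp add: powr_mult d_powr)
      also have "2 powr p * Lp_mass p f + 2 * pi * 3 powr p * \<epsilon>
          \<le> (2 powr p + 2 * pi * 3 powr p) * (Lp_mass p f + \<epsilon>)"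
        using Lp_mass_nonneg[of p f] \<open>0 < \<epsilon>\<close> by (simp add: algebra_simps)
      finally show ?thesis by (simp add: K_def mult.assoc)
    qed
    have f_eq: "f = (\<lambda>t. (of_real (v t) + \<i> * of_real (w t)) + (- (1 + \<i>)) * of_real (u t))"
      by (auto simp: v_def w_def complex_eq_iff)
    have "\<forall>\<^sub>F N in sequentially. (\<forall>t. fourier_sum N (\<lambda>t. of_real (u t)) t = of_real (u t))
        \<and> (\<forall>t. fourier_sum N (\<lambda>t. of_real (v t)) t = of_real (v t))
        \<and> (\<forall>t. fourier_sum N (\<lambda>t. of_real (w t)) t = of_real (w t))"
      by (intro eventually_conj fourier_sum_trig_poly u v w)
    then show "\<forall>\<^sub>F N in sequentially. Lp_mass p (riesz_proj N f)
        \<le> 2 powr p * (2 powr p * (C * K + C * K) + 2 powr p * (C * K)) * (Lp_mass p f + \<epsilon>)"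
    proof eventually_elim
      case (elim N)
      let ?P = "\<lambda>x. riesz_proj N (\<lambda>t. complex_of_real (x t))"
      let ?B = "C * K * (Lp_mass p f + \<epsilon>)"
      have B: "Lp_mass p (?P x) \<le> ?B"
        if "trig_poly (\<lambda>t. of_real (x t))" "\<And>t. t \<in> {-pi..pi} \<Longrightarrow> d \<le> x t"
          "\<And>t. t \<in> {-pi..pi} \<Longrightarrow> x t \<le> 2 * cmod (f t) + 3 * d"
          "\<And>t. fourier_sum N (\<lambda>t. of_real (x t)) t = of_real (x t)" for x
      proof -
        have "Lp_mass p (?P x) \<le> C * Lp_mass p (\<lambda>t. of_real (x t))"
          using \<open>0 < d\<close> that(2,4) by (rule C(2))
        also have "\<dots> \<le> C * (K * (Lp_mass p f + \<epsilon>))"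
          by (intro mult_left_mono K that C)
        finally show ?thesis by (simp only: mult.assoc)
      qed
      have B: "Lp_mass p (?P u) \<le> ?B" "Lp_mass p (?P v) \<le> ?B" "Lp_mass p (?P w) \<le> ?B"
        using elim by (intro B u v w ge le; simp)+
      have "riesz_proj N f t = (?P v t + \<i> * ?P w t) + (- (1 + \<i>)) * ?P u t" for t
        by (subst f_eq) (simp only: riesz_proj_add riesz_proj_mult trig_poly_integrable
            trig_poly_add trig_poly_mult trig_poly_const u v w)
      then have "Lp_mass p (riesz_proj N f)
          = Lp_mass p (\<lambda>t. (?P v t + \<i> * ?P w t) + (- (1 + \<i>)) * ?P u t)" by presburger
      also have "\<dots> \<le> 2 powr p * (Lp_mass p (\<lambda>t. ?P v t + \<i> * ?P w t)
          + Lp_mass p (\<lambda>t. (- (1 + \<i>)) * ?P u t))"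
        by (intro Lp_mass_add Lp_period_add Lp_period_mult riesz_proj_Lp_period p0)
      also have "\<dots> \<le> 2 powr p * (2 powr p * (?B + ?B) + 2 powr p * ?B)"
      proof (intro mult_left_mono add_mono)
        have "Lp_mass p (\<lambda>t. ?P v t + \<i> * ?P w t)
            \<le> 2 powr p * (Lp_mass p (?P v) + Lp_mass p (\<lambda>t. \<i> * ?P w t))"
          by (intro Lp_mass_add Lp_period_mult riesz_proj_Lp_period p0)
        also have "\<dots> \<le> 2 powr p * (?B + ?B)"
          using B by (intro mult_left_mono add_mono) (auto simp: Lp_mass_mult)
        finally show "Lp_mass p (\<lambda>t. ?P v t + \<i> * ?P w t) \<le> 2 powr p * (?B + ?B)" .
        have "cmod (- (1 + \<i>)) \<le> 2"
          using norm_triangle_ineq[of 1 \<i>] unfolding norm_minus_cancel by simp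
        then show "Lp_mass p (\<lambda>t. (- (1 + \<i>)) * ?P u t) \<le> 2 powr p * ?B"
          unfolding Lp_mass_mult using B(1) p0
          by (intro mult_mono powr_mono2) (auto simp: Lp_mass_nonneg)
      qed auto
      also have "\<dots> = 2 powr p * (2 powr p * (C * K + C * K) + 2 powr p * (C * K)) * (Lp_mass p f + \<epsilon>)"
        by (simp add: algebra_simps)
      finally show ?case .
    qed
  qed
qed

section \<open>Partial sums on trigonometric polynomials\<close>

text \<open>
  Conjugated by harmonics, the first projection keeps the frequencies from \<open>- n\<close> on, the second one
  those from \<open>n + 1\<close> on. The two truncation indices are chosen so that both stop at the same
  frequency \<open>N + n + 1\<close> and the tails cancel exactly.
\<close>
lemma fourier_sum_eq_riesz_proj_diff:
  "fourier_sum n f t = harmonic (- int n) t * riesz_proj (N + (2 * n + 1)) (\<lambda>t. harmonic (int n) t * f t) t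
      - harmonic (int n + 1) t * riesz_proj N (\<lambda>t. harmonic (- int n - 1) t * f t) t"
proof -
  define g where "g j = fourier_coeff f j * harmonic j t" for j
  have shift: "harmonic (- m) t * (fourier_coeff (\<lambda>t. harmonic m t * f t) k * harmonic k t) = g (k - m)"
    for m k
    using harmonic_add[of "- m" k t] unfolding g_def fourier_coeff_modulate
    by (simp add: mult.left_commute)
  have 1: "harmonic (- int n) t * riesz_proj M (\<lambda>t. harmonic (int n) t * f t) t
      = (\<Sum>k\<le>M. g (int k - int n))" for M
    unfolding riesz_proj_def sum_distrib_left shift ..
  have 2: "harmonic (int n + 1) t * riesz_proj M (\<lambda>t. harmonic (- int n - 1) t * f t) t
      = (\<Sum>k\<le>M. g (int (k + (2 * n + 1)) - int n))" for M
    using shift[of "- int n - 1"] unfolding riesz_proj_def sum_distrib_left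
    by (simp add: algebra_simps)
  have "(\<Sum>k\<le>N + (2 * n + 1). g (int k - int n))
      - (\<Sum>k\<le>N. g (int (k + (2 * n + 1)) - int n)) = (\<Sum>k\<le>2 * n. g (int k - int n))"
    by (induction N) auto
  also have "\<dots> = (\<Sum>j = - int n..int n. g j)"
    by (rule sum.reindex_bij_witness[of _ "\<lambda>j. nat (j + int n)" "\<lambda>k. int k - int n"]) auto
  also have "\<dots> = fourier_sum n f t" by (simp add: fourier_sum_eq g_def)
  finally show ?thesis unfolding 1 2 by simp
qed

lemma Lp_mass_modulate: "Lp_mass p (\<lambda>t. harmonic m t * f t) = Lp_mass p f"
  by (simp add: Lp_mass_def norm_mult)

text \<open>
  Modulation preserves the \<open>p\<close>-mass, so the bound for the projection is inherited with a constant
  independent of \<open>n\<close>. The partial sum does not depend on the truncation index \<open>N\<close>, which allows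
  \<open>\<epsilon>\<close> to tend to \<open>0\<close> at this point.
\<close>
lemma fourier_sum_bound_trig_poly:
  fixes p :: real
  assumes p: "1 < p" "p \<le> 2"
  obtains C where "0 \<le> C"
    "\<And>f n. trig_poly f \<Longrightarrow> Lp_mass p (fourier_sum n f) \<le> C * Lp_mass p f"
proof -
  obtain C where "0 \<le> C" and C: 
    "\<And>f \<epsilon>. \<lbrakk>trig_poly f; 0 < \<epsilon>\<rbrakk>
      \<Longrightarrow> \<forall>\<^sub>F N in sequentially. Lp_mass p (riesz_proj N f) \<le> C * (Lp_mass p f + \<epsilon>)"
    using riesz_proj_bound_trig_poly[OF p] by metis
  have p0: "0 < p" using p by simp
  let ?D = "2 powr p * (C + C)"
  have "Lp_mass p (fourier_sum n f) \<le> ?D * Lp_mass p f" if f: "trig_poly f" for f n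
  proof -
    have le: "Lp_mass p (fourier_sum n f) \<le> ?D * (Lp_mass p f + \<epsilon>)" if "0 < \<epsilon>" for \<epsilon>
    proof -
      define f1 where "f1 = (\<lambda>t. harmonic (int n) t * f t)"
      define f2 where "f2 = (\<lambda>t. harmonic (- int n - 1) t * f t)"
      have "trig_poly f1" "trig_poly f2"
        using trig_poly_mult_harmonic[OF f, of 1] by (simp_all add: f1_def f2_def)
      then have ev: "\<forall>\<^sub>F N in sequentially. Lp_mass p (riesz_proj N f1) \<le> C * (Lp_mass p f + \<epsilon>)"
        "\<forall>\<^sub>F N in sequentially. Lp_mass p (riesz_proj N f2) \<le> C * (Lp_mass p f + \<epsilon>)"
        using C[of f1 \<epsilon>] C[of f2 \<epsilon>] \<open>0 < \<epsilon>\<close> by (simp_all add: f1_def f2_def Lp_mass_modulate)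
      obtain N where N: "\<And>M. N \<le> M \<Longrightarrow> Lp_mass p (riesz_proj M f1) \<le> C * (Lp_mass p f + \<epsilon>)"
        "\<And>M. N \<le> M \<Longrightarrow> Lp_mass p (riesz_proj M f2) \<le> C * (Lp_mass p f + \<epsilon>)"
        using eventually_conj[OF ev] unfolding eventually_sequentially by blast
      let ?g1 = "\<lambda>t. harmonic (- int n) t * riesz_proj (N + (2 * n + 1)) f1 t"
      let ?g2 = "\<lambda>t. harmonic (int n + 1) t * riesz_proj N f2 t"
      have "fourier_sum n f t = ?g1 t - ?g2 t" for t
        unfolding f1_def f2_def by (rule fourier_sum_eq_riesz_proj_diff)
      then have "Lp_mass p (fourier_sum n f) = Lp_mass p (\<lambda>t. ?g1 t - ?g2 t)" by presburger
      also have "\<dots> \<le> 2 powr p * (Lp_mass p ?g1 + Lp_mass p ?g2)"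
      proof (intro Lp_mass_diff p0)
        show "?g1 \<in> Lp_period p" "?g2 \<in> Lp_period p"
          unfolding riesz_proj_def by (intro Lp_period_continuous continuous_intros p0)+
      qed
      also have "\<dots> \<le> 2 powr p * (C * (Lp_mass p f + \<epsilon>) + C * (Lp_mass p f + \<epsilon>))"
        unfolding Lp_mass_modulate by (intro mult_left_mono add_mono N) auto
      also have "\<dots> = ?D * (Lp_mass p f + \<epsilon>)" by (simp add: algebra_simps)
      finally show ?thesis .
    qed
    show ?thesis
    proof (rule tendsto_lowerbound[OF _ _ trivial_limit_at_right_real])
      show "((\<lambda>\<epsilon>. ?D * (Lp_mass p f + \<epsilon>)) \<longlongrightarrow> ?D * Lp_mass p f) (at_right 0)"
        by (auto intro!: tendsto_eq_intros)
      show "\<forall>\<^sub>F \<epsilon> in at_right 0. Lp_mass p (fourier_sum n f) \<le> ?D * (Lp_mass p f + \<epsilon>)"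
        using le by (auto simp: eventually_at_right_less eventually_at_filter)
    qed
  qed
  moreover have "0 \<le> ?D" using \<open>0 \<le> C\<close> by simp
  ultimately show thesis using that by blast
qed

section \<open>Extension to all of \<open>L\<^sup>p\<close>\<close>

lemma fourier_sum_Lp_period: "0 < p \<Longrightarrow> fourier_sum n f \<in> Lp_period p"
  by (intro Lp_period_continuous continuous_intros)

lemma norm_fourier_sum_le:
  assumes "integrable circle f"
  shows "cmod (fourier_sum n f t) \<le> (2 * real n + 1) * (\<integral>t. cmod (f t) \<partial>circle)"
proof -
  have "cmod (fourier_sum n f t) \<le> (\<Sum>j = - int n..int n. \<integral>t. cmod (f t) \<partial>circle)"
    unfolding fourier_sum_eq
    by (rule sum_norm_le) (simp add: norm_mult norm_fourier_coeff_le[OF assms])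
  also have "\<dots> = (2 * real n + 1) * (\<integral>t. cmod (f t) \<partial>circle)" by simp
  finally show ?thesis .
qed

lemma trig_poly_dense_L1_Lp:
  assumes f: "f \<in> Lp_period p" and "1 \<le> p" "0 < e"
  obtains g where "trig_poly g" "Lp_mass p (\<lambda>t. f t - g t) < e"
    "(\<integral>t. cmod (f t - g t) \<partial>circle) \<le> e"
proof -
  define \<eta> where "\<eta> = e / (4 * pi)"
  have "0 < \<eta>" using \<open>0 < e\<close> by (simp add: \<eta>_def)
  define d where "d = min e (e / 2 / \<eta> powr (1 - p))"
  have "0 < d" using \<open>0 < e\<close> \<open>0 < \<eta>\<close> by (simp add: d_def)
  obtain g where g: "trig_poly g" "Lp_mass p (\<lambda>t. f t - g t) < d"
    using trig_poly_dense[OF f _ \<open>0 < d\<close>] assms by auto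
  have "(\<lambda>t. f t - g t) \<in> Lp_period p"
    using assms g by (intro Lp_period_diff f trig_poly_Lp_period) auto
  then have "(\<integral>t. cmod (f t - g t) \<partial>circle) \<le> 2 * pi * \<eta> + \<eta> powr (1 - p) * Lp_mass p (\<lambda>t. f t - g t)"
    by (intro L1_norm_le_Lp_mass assms \<open>0 < \<eta>\<close>)
  also have "\<dots> \<le> 2 * pi * \<eta> + \<eta> powr (1 - p) * (e / 2 / \<eta> powr (1 - p))"
    using g(2) by (intro add_left_mono mult_left_mono) (auto simp: d_def)
  also have "\<dots> = e" using \<open>0 < \<eta>\<close> by (simp add: \<eta>_def)
  finally show thesis using that g by (simp add: d_def)
qed

text \<open>
  For fixed \<open>n\<close> the operator \<open>fourier_sum n\<close> is continuous from \<open>L\<^sup>1\<close> to bounded functions, with a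
  norm depending on \<open>n\<close>. Along an approximation by trigonometric polynomials in both \<open>L\<^sup>1\<close> and
  \<open>L\<^sup>p\<close>, this bad constant only multiplies a term tending to \<open>0\<close>, and the uniform one survives.
\<close>
lemma fourier_sum_bound_le_2:
  fixes p :: real
  assumes p: "1 < p" "p \<le> 2"
  obtains C where "0 \<le> C"
    "\<And>f n. f \<in> Lp_period p \<Longrightarrow> Lp_mass p (fourier_sum n f) \<le> C * Lp_mass p f"
proof -
  obtain C where "0 \<le> C" and C:
    "\<And>f n. trig_poly f \<Longrightarrow> Lp_mass p (fourier_sum n f) \<le> C * Lp_mass p f"
    using fourier_sum_bound_trig_poly[OF p] by metis
  have p0: "0 < p" "1 \<le> p" using p by auto
  have "Lp_mass p (fourier_sum n f) \<le> 2 powr p * (C * 2 powr p) * Lp_mass p f"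
    if f: "f \<in> Lp_period p" for f n
  proof -
    let ?R = "\<lambda>e. 2 powr p * (2 * pi * ((2 * real n + 1) * e) powr p
        + C * (2 powr p * (Lp_mass p f + e)))"
    have le: "Lp_mass p (fourier_sum n f) \<le> ?R e" if "0 < e" for e
    proof -
      obtain g where g: "trig_poly g" "Lp_mass p (\<lambda>t. f t - g t) < e"
        and L1: "(\<integral>t. cmod (f t - g t) \<partial>circle) \<le> e"
        using trig_poly_dense_L1_Lp[OF f p0(2) \<open>0 < e\<close>] by blast
      have gp: "g \<in> Lp_period p" using g p0 by (intro trig_poly_Lp_period)
      have fgp: "(\<lambda>t. f t - g t) \<in> Lp_period p" by (intro Lp_period_diff f gp p0)
      note int = Lp_period_integrable[OF f p0(2)] Lp_period_integrable[OF gp p0(2)]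
        Lp_period_integrable[OF fgp p0(2)]
      have "fourier_sum n f t = fourier_sum n (\<lambda>t. f t - g t) t + fourier_sum n g t" for t
        by (simp add: fourier_sum_diff[OF int(1,2)])
      then have "Lp_mass p (fourier_sum n f)
          = Lp_mass p (\<lambda>t. fourier_sum n (\<lambda>t. f t - g t) t + fourier_sum n g t)" by presburger
      also have "\<dots> \<le> 2 powr p * (Lp_mass p (fourier_sum n (\<lambda>t. f t - g t)) + Lp_mass p (fourier_sum n g))"
        by (intro Lp_mass_add fourier_sum_Lp_period p0)
      also have "\<dots> \<le> ?R e"
      proof (intro mult_left_mono add_mono)
        have "cmod (fourier_sum n (\<lambda>t. f t - g t) t) \<le> (2 * real n + 1) * e" for t
          by (rule order_trans[OF norm_fourier_sum_le[OF int(3)]]) (intro mult_left_mono L1, simp)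
        then show "Lp_mass p (fourier_sum n (\<lambda>t. f t - g t)) \<le> 2 * pi * ((2 * real n + 1) * e) powr p"
          by (intro Lp_mass_le_bound fourier_sum_Lp_period p0)
        have "Lp_mass p (\<lambda>t. f t - (f t - g t)) \<le> 2 powr p * (Lp_mass p f + Lp_mass p (\<lambda>t. f t - g t))"
          by (intro Lp_mass_diff f fgp p0)
        also have "\<dots> \<le> 2 powr p * (Lp_mass p f + e)"
          using g(2) by (intro mult_left_mono add_left_mono) auto
        finally have "Lp_mass p g \<le> 2 powr p * (Lp_mass p f + e)" by simp
        then show "Lp_mass p (fourier_sum n g) \<le> C * (2 powr p * (Lp_mass p f + e))"
          using C[OF g(1), of n] \<open>0 \<le> C\<close> by (meson mult_left_mono order_trans)
      qed simp
      finally show ?thesis .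
    qed
    show ?thesis
    proof (rule tendsto_lowerbound[OF _ _ trivial_limit_at_right_real])
      have "((\<lambda>e. (2 * real n + 1) * e) \<longlongrightarrow> 0) (at_right 0)"
        by (auto intro!: tendsto_eq_intros)
      moreover have "\<forall>\<^sub>F e in at_right 0. 0 \<le> (2 * real n + 1) * e"
        by (auto simp: eventually_at_filter)
      ultimately have "((\<lambda>e. ((2 * real n + 1) * e) powr p) \<longlongrightarrow> 0 powr p) (at_right 0)"
        using p0 by (intro tendsto_powr') auto
      then have "(?R \<longlongrightarrow> 2 powr p * (2 * pi * 0 powr p + C * (2 powr p * (Lp_mass p f + 0)))) (at_right 0)"
        by (intro tendsto_mult tendsto_add tendsto_const tendsto_ident_at)
      then show "(?R \<longlongrightarrow> 2 powr p * (C * 2 powr p) * Lp_mass p f) (at_right 0)"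
        by (simp add: mult.assoc)
      show "\<forall>\<^sub>F e in at_right 0. Lp_mass p (fourier_sum n f) \<le> ?R e"
        using le by (auto simp: eventually_at_filter)
    qed
  qed
  moreover have "0 \<le> 2 powr p * (C * 2 powr p)" using \<open>0 \<le> C\<close> by simp
  ultimately show thesis using that by blast
qed

section \<open>Duality\<close>

text \<open>
  The Dirichlet kernel is even, so \<open>fourier_sum n\<close> is symmetric for the bilinear pairing. On the level of
  coefficients this is the substitution of \<open>- j\<close> for \<open>j\<close>.
\<close>
lemma integral_fourier_sum_mult:
  assumes f: "integrable circle f" and g: "integrable circle g"
  shows "(\<integral>t. fourier_sum n f t * g t \<partial>circle) = (\<integral>t. f t * fourier_sum n g t \<partial>circle)"
proof -
  have coeff: "(\<integral>t. x t * harmonic j t \<partial>circle) = 2 * of_real pi * fourier_coeff x (- j)" for x j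
    by (simp add: fourier_coeff_eq)
  have pair: "(\<integral>t. fourier_sum n x t * y t \<partial>circle)
      = (\<Sum>j = - int n..int n. 2 * of_real pi * (fourier_coeff x j * fourier_coeff y (- j)))"
    if y: "integrable circle y" for x y
  proof -
    have "(\<integral>t. fourier_sum n x t * y t \<partial>circle)
        = (\<integral>t. (\<Sum>j = - int n..int n. fourier_coeff x j * (y t * harmonic j t)) \<partial>circle)"
      unfolding fourier_sum_eq sum_distrib_right by (simp only: mult_ac)
    also have "\<dots> = (\<Sum>j = - int n..int n. fourier_coeff x j * (\<integral>t. y t * harmonic j t \<partial>circle))"
      by (simp add: integrable_mult_harmonic[OF y])
    finally show ?thesis by (simp add: coeff mult_ac)
  qed
  have "(\<integral>t. f t * fourier_sum n g t \<partial>circle) = (\<integral>t. fourier_sum n g t * f t \<partial>circle)"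
    by (simp add: mult.commute)
  also have "\<dots> = (\<Sum>j = - int n..int n. 2 * of_real pi * (fourier_coeff g j * fourier_coeff f (- j)))"
    by (rule pair[OF f])
  also have "\<dots> = (\<Sum>j = - int n..int n. 2 * of_real pi * (fourier_coeff f j * fourier_coeff g (- j)))"
    by (rule sum.reindex_bij_witness[of _ uminus uminus]) auto
  also have "\<dots> = (\<integral>t. fourier_sum n f t * g t \<partial>circle)" by (rule pair[OF g, symmetric])
  finally show ?thesis ..
qed

lemma Youngs_inequality_scaled:
  fixes p q s a b :: real
  assumes "1 < p" "1 < q" "1 / p + 1 / q = 1" "0 < s" "0 \<le> a" "0 \<le> b"
  shows "a * b \<le> (1 / s) powr p * a powr p + s powr q * b powr q"
proof -
  have "a * b = (1 / s * a) * (s * b)" using assms by simp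
  also have "\<dots> \<le> (1 / s * a) powr p / p + (s * b) powr q / q"
    using assms by (intro Youngs_inequality) auto
  also have "\<dots> \<le> (1 / s * a) powr p / 1 + (s * b) powr q / 1"
    using assms by (intro add_mono divide_left_mono) auto
  also have "\<dots> = (1 / s) powr p * a powr p + s powr q * b powr q"
    using assms by (simp only: powr_mult div_by_1)
  finally show ?thesis .
qed

text \<open>
  Duality with the conjugate exponent \<open>q \<le> 2\<close>. The function \<open>g = \<bar>h\<bar>\<^sup>p\<^sup>-\<^sup>2 cnj h\<close> is extremal for
  \<open>h = fourier_sum n f\<close>: both \<open>h * g\<close> and \<open>\<bar>g\<bar>\<^sup>q\<close> equal \<open>\<bar>h\<bar>\<^sup>p\<close>. Moving the partial sum onto \<open>g\<close> and applying
  Young's inequality with a weight \<open>s\<close> so small that the contribution of \<open>fourier_sum n g\<close> is at most half the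
  \<open>p\<close>-mass of \<open>h\<close>, that contribution is absorbed on the left. The absorption is legitimate because \<open>h\<close> is
  continuous and its \<open>p\<close>-mass is finite.
\<close>
lemma fourier_sum_bound_ge_2:
  fixes p :: real
  assumes p: "2 \<le> p"
  obtains C where "0 \<le> C"
    "\<And>f n. f \<in> Lp_period p \<Longrightarrow> Lp_mass p (fourier_sum n f) \<le> C * Lp_mass p f"
proof -
  define q where "q = p / (p - 1)"
  have q: "1 < q" "q \<le> 2" "1 / p + 1 / q = 1" "(p - 1) * q = p"
    using p by (auto simp: q_def field_simps)
  have p0: "0 < p" "1 \<le> p" "1 < p" using p by auto
  obtain C where "0 \<le> C" and C:
    "\<And>f n. f \<in> Lp_period q \<Longrightarrow> Lp_mass q (fourier_sum n f) \<le> C * Lp_mass q f"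
    using fourier_sum_bound_le_2[OF q(1,2)] by metis
  define s where "s = (1 / (2 * (C + 1))) powr (1 / q)"
  have "0 < s" and s: "s powr q = 1 / (2 * (C + 1))"
    using \<open>0 \<le> C\<close> q by (auto simp: s_def powr_powr)
  define K where "K = (1 / s) powr p"
  have "0 \<le> K" by (simp add: K_def)
  have "Lp_mass p (fourier_sum n f) \<le> 2 * K * Lp_mass p f" if f: "f \<in> Lp_period p" for f n
  proof -
    define h where "h = fourier_sum n f"
    define g where "g t = of_real (cmod (h t) powr (p - 2)) * cnj (h t)" for t
    have hp: "h \<in> Lp_period p" unfolding h_def by (rule fourier_sum_Lp_period[OF p0(1)])
    then have hm: "h \<in> borel_measurable circle" by (simp add: Lp_period_def)
    have norm_g: "cmod (g t) = cmod (h t) powr (p - 1)" for t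
    proof (cases "h t = 0")
      case False
      then have "cmod (g t) = cmod (h t) powr (p - 2) * cmod (h t) powr 1"
        by (simp add: g_def norm_mult)
      also have "\<dots> = cmod (h t) powr (p - 1)"
        using powr_add[of "cmod (h t)" "p - 2" 1] by simp
      finally show ?thesis .
    qed (simp add: g_def)
    have norm_g_q: "cmod (g t) powr q = cmod (h t) powr p" for t
      by (simp add: norm_g powr_powr q(4))
    have "g \<in> borel_measurable circle"
    proof -
      have "(\<lambda>t. cnj (h t)) \<in> borel_measurable circle"
        by (rule measurable_compose[OF hm])
          (intro borel_measurable_continuous_onI continuous_intros)
      then show ?thesis unfolding g_def using hm by measurable
    qed
    then have gq: "g \<in> Lp_period q" using hp by (simp add: Lp_period_def norm_g_q)
    have mass_g: "Lp_mass q g = Lp_mass p h" by (simp add: Lp_mass_def norm_g_q)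
    have hg: "h t * g t = of_real (cmod (h t) powr p)" for t
    proof (cases "h t = 0")
      case False
      have "cmod (h t) powr p = cmod (h t) powr (p - 2) * (cmod (h t))\<^sup>2"
        using powr_add[of "cmod (h t)" "p - 2" 2] False by simp
      then have "of_real (cmod (h t) powr p) = of_real (cmod (h t) powr (p - 2)) * (h t * cnj (h t))"
        by (simp only: of_real_mult complex_norm_square)
      then show ?thesis by (simp add: g_def mult_ac)
    qed (use p0 in simp)
    have Sgq: "fourier_sum n g \<in> Lp_period q" using q by (intro fourier_sum_Lp_period) simp
    have i: "integrable circle f" "integrable circle g"
      using Lp_period_integrable[OF f p0(2)] Lp_period_integrable[OF gq] q by auto
    have ip: "integrable circle (\<lambda>t. cmod (f t) powr p)"
        "integrable circle (\<lambda>t. cmod (fourier_sum n g t) powr q)"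
      using f Sgq by (auto simp: Lp_period_def)
    have young: "cmod (f t * fourier_sum n g t)
        \<le> K * cmod (f t) powr p + 1 / (2 * (C + 1)) * cmod (fourier_sum n g t) powr q" for t
      using Youngs_inequality_scaled[OF p0(3) q(1,3) \<open>0 < s\<close>, of "cmod (f t)" "cmod (fourier_sum n g t)"]
      by (simp add: norm_mult K_def s)
    have iK: "integrable circle
        (\<lambda>t. K * cmod (f t) powr p + 1 / (2 * (C + 1)) * cmod (fourier_sum n g t) powr q)"
      using ip by (intro Bochner_Integration.integrable_add integrable_mult_right)
    have iprod: "integrable circle (\<lambda>t. f t * fourier_sum n g t)"
    proof (rule Bochner_Integration.integrable_bound[OF iK])
      show "(\<lambda>t. f t * fourier_sum n g t) \<in> borel_measurable circle"
        using f Sgq by (auto simp: Lp_period_def)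
      show "AE t in circle. cmod (f t * fourier_sum n g t)
          \<le> norm (K * cmod (f t) powr p + 1 / (2 * (C + 1)) * cmod (fourier_sum n g t) powr q)"
        unfolding real_norm_def by (intro AE_I2 order_trans[OF young abs_ge_self])
    qed
    have "complex_of_real (Lp_mass p h) = (\<integral>t. h t * g t \<partial>circle)"
      unfolding hg Lp_mass_def by (rule integral_complex_of_real[symmetric])
    also have "\<dots> = (\<integral>t. f t * fourier_sum n g t \<partial>circle)"
      unfolding h_def by (rule integral_fourier_sum_mult[OF i])
    finally have "Lp_mass p h = cmod (\<integral>t. f t * fourier_sum n g t \<partial>circle)"
      by (metis Lp_mass_nonneg abs_of_nonneg norm_of_real)
    also have "\<dots> \<le> (\<integral>t. cmod (f t * fourier_sum n g t) \<partial>circle)"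
      by (rule integral_norm_bound)
    also have "\<dots> \<le> (\<integral>t. K * cmod (f t) powr p
        + 1 / (2 * (C + 1)) * cmod (fourier_sum n g t) powr q \<partial>circle)"
      by (intro integral_mono integrable_norm iprod iK young)
    also have "\<dots> = K * Lp_mass p f + 1 / (2 * (C + 1)) * Lp_mass q (fourier_sum n g)"
      using ip by (simp add: Lp_mass_def)
    also have "\<dots> \<le> K * Lp_mass p f + 1 / (2 * (C + 1)) * (C * Lp_mass p h)"
      using C[OF gq, of n] \<open>0 \<le> C\<close> by (intro add_left_mono mult_left_mono) (auto simp: mass_g)
    also have "\<dots> \<le> K * Lp_mass p f + 1 / 2 * Lp_mass p h"
    proof -
      have "1 / (2 * (C + 1)) * C \<le> 1 / 2" using \<open>0 \<le> C\<close> by (simp add: field_simps)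
      from mult_right_mono[OF this Lp_mass_nonneg[of p h]] show ?thesis by (simp add: mult.assoc)
    qed
    finally show ?thesis by (simp add: h_def)
  qed
  moreover have "0 \<le> 2 * K" using \<open>0 \<le> K\<close> by simp
  ultimately show thesis using that by blast
qed

section \<open>Norm convergence\<close>

lemma fourier_sum_bound:
  fixes p :: real
  assumes "1 < p"
  obtains C where "0 \<le> C"
    "\<And>f n. f \<in> Lp_period p \<Longrightarrow> Lp_mass p (fourier_sum n f) \<le> C * Lp_mass p f"
  using fourier_sum_bound_le_2[OF assms] fourier_sum_bound_ge_2[of p] by (metis linear)

text \<open>
  For a trigonometric polynomial \<open>g\<close> the partial sums are eventually equal to \<open>g\<close>, so the error for \<open>f\<close>
  is eventually that for \<open>f - g\<close>, which the uniform bound makes small by density.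
\<close>
lemma Lp_mass_fourier_sum_diff_tendsto_0:
  fixes p :: real
  assumes "1 < p" and f: "f \<in> Lp_period p"
  shows "(\<lambda>n. Lp_mass p (\<lambda>t. fourier_sum n f t - f t)) \<longlonglongrightarrow> 0"
proof -
  obtain C where "0 \<le> C" and C:
    "\<And>f n. f \<in> Lp_period p \<Longrightarrow> Lp_mass p (fourier_sum n f) \<le> C * Lp_mass p f"
    using fourier_sum_bound[OF \<open>1 < p\<close>] by metis
  have p0: "0 < p" "1 \<le> p" using \<open>1 < p\<close> by auto
  show ?thesis
  proof (rule order_tendstoI)
    fix a :: real assume "a < 0"
    then show "\<forall>\<^sub>F n in sequentially. a < Lp_mass p (\<lambda>t. fourier_sum n f t - f t)"
      by (intro always_eventually allI less_le_trans[OF _ Lp_mass_nonneg])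
  next
    fix e :: real assume "0 < e"
    define d where "d = e / (2 powr p * (C + 1))"
    have "0 < d" using \<open>0 < e\<close> \<open>0 \<le> C\<close> by (simp add: d_def)
    obtain g where g: "trig_poly g" "Lp_mass p (\<lambda>t. f t - g t) < d"
      using trig_poly_dense[OF f p0(1) \<open>0 < d\<close>] by blast
    let ?r = "\<lambda>t. f t - g t"
    have gp: "g \<in> Lp_period p" using g p0 by (intro trig_poly_Lp_period)
    have rp: "?r \<in> Lp_period p" by (intro Lp_period_diff f gp p0)
    show "\<forall>\<^sub>F n in sequentially. Lp_mass p (\<lambda>t. fourier_sum n f t - f t) < e"
      using fourier_sum_trig_poly[OF g(1)]
    proof eventually_elim
      case (elim n)
      have "fourier_sum n f t - f t = fourier_sum n ?r t - ?r t" for t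
        using elim
        by (simp add: fourier_sum_diff[OF Lp_period_integrable[OF f p0(2)] Lp_period_integrable[OF gp p0(2)]])
      then have "Lp_mass p (\<lambda>t. fourier_sum n f t - f t)
          = Lp_mass p (\<lambda>t. fourier_sum n ?r t - ?r t)" by presburger
      also have "\<dots> \<le> 2 powr p * (Lp_mass p (fourier_sum n ?r) + Lp_mass p ?r)"
        by (intro Lp_mass_diff fourier_sum_Lp_period rp p0)
      also have "\<dots> \<le> 2 powr p * (C * Lp_mass p ?r + Lp_mass p ?r)"
        by (intro mult_left_mono add_right_mono C rp) simp
      also have "\<dots> = 2 powr p * (C + 1) * Lp_mass p ?r" by (simp add: algebra_simps)
      also have "\<dots> < 2 powr p * (C + 1) * d"
        using g(2) \<open>0 \<le> C\<close> by (intro mult_strict_left_mono) auto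
      also have "\<dots> = e" using \<open>0 \<le> C\<close> by (simp add: d_def)
      finally show ?case .
    qed
  qed
qed

theorem theorem9p5:
  fixes p :: real and f :: "real \<Rightarrow> complex"
  assumes "1 < p" and "f \<in> Lp_circle p"
  shows "(\<lambda>n. Lp_norm_circle p (\<lambda>t. fourier_sum n f t - f t)) \<longlonglongrightarrow> 0"
proof -
  have "(\<lambda>n. 1 / (2 * pi) * Lp_mass p (\<lambda>t. fourier_sum n f t - f t)) \<longlonglongrightarrow> 1 / (2 * pi) * 0"
    using assms by (intro tendsto_mult_left Lp_mass_fourier_sum_diff_tendsto_0 Lp_circle_imp_Lp_period)
  then have "(\<lambda>n. (1 / (2 * pi) * Lp_mass p (\<lambda>t. fourier_sum n f t - f t)) powr (1 / p))
      \<longlonglongrightarrow> 0 powr (1 / p)"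
    using assms by (intro tendsto_powr') (auto simp: Lp_mass_nonneg)
  then show ?thesis by (simp add: Lp_norm_circle_eq)
qed

end
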